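(* Over $\mathsf{RCA}_0$ the following are equivalent: (1) $\mathsf{ACA}_0$; (2) for every countable sequence of graphs $\langle G_i : i\in\mathbb{N}\rangle$ there is a set $Z\subseteq\mathbb{N}$ such that $i\in Z$ if and only if $G_i$ has an Euler path.
   Context: Work in second-order arithmetic, whose number variables range over $\mathbb{N}$ and set variables over subsets of $\mathbb{N}$; finite sequences, functions, sequences of graphs, etc. are coded by sets of natural numbers in the standard way. $\mathsf{RCA}_0$ is the subsystem consisting of the basic axioms of Peano arithmetic, induction restricted to $\Sigma^0_1$ formulas, and recursive comprehension (any set definable by both a $\Sigma^0_1$ formula and a $\Pi^0_1$ formula, with set parameters, exists). $\mathsf{ACA}_0$ is $\mathsf{RCA}_0$ together with arithmetical comprehension: every set definable by a formula with no set quantifiers (set parameters allowed) exists. A graph $G=\langle V,E\rangle$ has vertex set $V\subseteq\mathbb{N}$ and edge set $E$ a set of unordered pairs of elements of $V$. A path in $G$ is a sequence of vertices $v_0,v_1,v_2,\dots$ (indexed by $\mathbb{N}$) such that $(v_i,v_{i+1})\in E$ for every $i$; it is an Euler path if it uses every edge of $G$ exactly once. *)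

theory Defs
  imports Main
begin

section \<open>The language of second-order arithmetic and its structures\<close>

datatype tm = Var nat | Zero | One | Plus tm tm | Times tm tm

text \<open>Number variables and set variables are two separate families, each named by \<open>nat\<close>.\<close>

datatype fm =
    Eq tm tm | Less tm tm | Mem tm nat
  | Neg fm | And fm fm | Or fm fm | Imp fm fm
  | All nat fm | Ex nat fm
  | SAll nat fm | SEx nat fm

text \<open>
  In an \<open>L\<^sub>2\<close>-structure the number variables range over the whole type \<open>'a\<close>, which may be
  nonstandard, and the set variables range over \<open>setsM M\<close> only.  Equality is true equality.
\<close>

record 'a l2_struct =
  zeroM :: 'a
  oneM :: 'a
  plusM :: "'a \<Rightarrow> 'a \<Rightarrow> 'a"
  timesM :: "'a \<Rightarrow> 'a \<Rightarrow> 'a"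
  lessM :: "'a \<Rightarrow> 'a \<Rightarrow> bool"
  setsM :: "'a set set"

primrec tm_val :: "'a l2_struct \<Rightarrow> (nat \<Rightarrow> 'a) \<Rightarrow> tm \<Rightarrow> 'a" where
  "tm_val M e (Var x) = e x"
| "tm_val M e Zero = zeroM M"
| "tm_val M e One = oneM M"
| "tm_val M e (Plus s t) = plusM M (tm_val M e s) (tm_val M e t)"
| "tm_val M e (Times s t) = timesM M (tm_val M e s) (tm_val M e t)"

primrec sat :: "'a l2_struct \<Rightarrow> (nat \<Rightarrow> 'a) \<Rightarrow> (nat \<Rightarrow> 'a set) \<Rightarrow> fm \<Rightarrow> bool" where
  "sat M e E (Eq s t) \<longleftrightarrow> tm_val M e s = tm_val M e t"
| "sat M e E (Less s t) \<longleftrightarrow> lessM M (tm_val M e s) (tm_val M e t)"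
| "sat M e E (Mem t X) \<longleftrightarrow> tm_val M e t \<in> E X"
| "sat M e E (Neg p) \<longleftrightarrow> \<not> sat M e E p"
| "sat M e E (And p q) \<longleftrightarrow> sat M e E p \<and> sat M e E q"
| "sat M e E (Or p q) \<longleftrightarrow> sat M e E p \<or> sat M e E q"
| "sat M e E (Imp p q) \<longleftrightarrow> (sat M e E p \<longrightarrow> sat M e E q)"
| "sat M e E (All x p) \<longleftrightarrow> (\<forall>a. sat M (e(x := a)) E p)"
| "sat M e E (Ex x p) \<longleftrightarrow> (\<exists>a. sat M (e(x := a)) E p)"
| "sat M e E (SAll X p) \<longleftrightarrow> (\<forall>A\<in>setsM M. sat M e (E(X := A)) p)"
| "sat M e E (SEx X p) \<longleftrightarrow> (\<exists>A\<in>setsM M. sat M e (E(X := A)) p)"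

primrec tm_vars :: "tm \<Rightarrow> nat set" where
  "tm_vars (Var x) = {x}"
| "tm_vars Zero = {}"
| "tm_vars One = {}"
| "tm_vars (Plus s t) = tm_vars s \<union> tm_vars t"
| "tm_vars (Times s t) = tm_vars s \<union> tm_vars t"

inductive Delta00 :: "fm \<Rightarrow> bool" where
  "Delta00 (Eq s t)"
| "Delta00 (Less s t)"
| "Delta00 (Mem t X)"
| "Delta00 p \<Longrightarrow> Delta00 (Neg p)"
| "Delta00 p \<Longrightarrow> Delta00 q \<Longrightarrow> Delta00 (And p q)"
| "Delta00 p \<Longrightarrow> Delta00 q \<Longrightarrow> Delta00 (Or p q)"
| "Delta00 p \<Longrightarrow> Delta00 q \<Longrightarrow> Delta00 (Imp p q)"
| "Delta00 p \<Longrightarrow> x \<notin> tm_vars t \<Longrightarrow> Delta00 (All x (Imp (Less (Var x) t) p))"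
| "Delta00 p \<Longrightarrow> x \<notin> tm_vars t \<Longrightarrow> Delta00 (Ex x (And (Less (Var x) t) p))"

inductive Sigma01 :: "fm \<Rightarrow> bool" where
  "Delta00 p \<Longrightarrow> Sigma01 (Ex x p)"

inductive Pi01 :: "fm \<Rightarrow> bool" where
  "Delta00 p \<Longrightarrow> Pi01 (All x p)"

primrec arithmetical :: "fm \<Rightarrow> bool" where
  "arithmetical (Eq s t) \<longleftrightarrow> True"
| "arithmetical (Less s t) \<longleftrightarrow> True"
| "arithmetical (Mem t X) \<longleftrightarrow> True"
| "arithmetical (Neg p) \<longleftrightarrow> arithmetical p"
| "arithmetical (And p q) \<longleftrightarrow> arithmetical p \<and> arithmetical q"
| "arithmetical (Or p q) \<longleftrightarrow> arithmetical p \<and> arithmetical q"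
| "arithmetical (Imp p q) \<longleftrightarrow> arithmetical p \<and> arithmetical q"
| "arithmetical (All x p) \<longleftrightarrow> arithmetical p"
| "arithmetical (Ex x p) \<longleftrightarrow> arithmetical p"
| "arithmetical (SAll X p) \<longleftrightarrow> False"
| "arithmetical (SEx X p) \<longleftrightarrow> False"

section \<open>The axiom systems\<close>

definition basic_axioms :: "'a l2_struct \<Rightarrow> bool" where
  "basic_axioms M \<longleftrightarrow>
     (\<forall>n. plusM M n (oneM M) \<noteq> zeroM M) \<and>
     (\<forall>m n. plusM M m (oneM M) = plusM M n (oneM M) \<longrightarrow> m = n) \<and>
     (\<forall>m. plusM M m (zeroM M) = m) \<and>
     (\<forall>m n. plusM M m (plusM M n (oneM M)) = plusM M (plusM M m n) (oneM M)) \<and>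
     (\<forall>m. timesM M m (zeroM M) = zeroM M) \<and>
     (\<forall>m n. timesM M m (plusM M n (oneM M)) = plusM M (timesM M m n) m) \<and>
     (\<forall>m. \<not> lessM M m (zeroM M)) \<and>
     (\<forall>m n. lessM M m (plusM M n (oneM M)) \<longleftrightarrow> lessM M m n \<or> m = n)"

text \<open>
  Each schema below is truth in \<open>M\<close> of the universal closure of all its instances: the
  environments \<open>e\<close>, \<open>E\<close> supply the number and set parameters, \<open>x\<close> is the distinguished
  variable, and updating \<open>e\<close> at \<open>x\<close> replaces substitution for \<open>x\<close>.
  The set variable that receives a comprehension is not in the scope of the environments, so
  the usual proviso that it is not free in the formula is automatic.
\<close>

definition Sigma01_induction :: "'a l2_struct \<Rightarrow> bool" where
  "Sigma01_induction M \<longleftrightarrow>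
     (\<forall>p x e E. Sigma01 p \<longrightarrow> range E \<subseteq> setsM M \<longrightarrow>
        sat M (e(x := zeroM M)) E p \<longrightarrow>
        (\<forall>a. sat M (e(x := a)) E p \<longrightarrow> sat M (e(x := plusM M a (oneM M))) E p) \<longrightarrow>
        (\<forall>a. sat M (e(x := a)) E p))"

definition Delta01_comprehension :: "'a l2_struct \<Rightarrow> bool" where
  "Delta01_comprehension M \<longleftrightarrow>
     (\<forall>p q x e E. Sigma01 p \<longrightarrow> Pi01 q \<longrightarrow> range E \<subseteq> setsM M \<longrightarrow>
        (\<forall>a. sat M (e(x := a)) E p \<longleftrightarrow> sat M (e(x := a)) E q) \<longrightarrow>
        {a. sat M (e(x := a)) E p} \<in> setsM M)"

definition arithmetical_comprehension :: "'a l2_struct \<Rightarrow> bool" where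
  "arithmetical_comprehension M \<longleftrightarrow>
     (\<forall>p x e E. arithmetical p \<longrightarrow> range E \<subseteq> setsM M \<longrightarrow>
        {a. sat M (e(x := a)) E p} \<in> setsM M)"

text \<open>
  The premise \<open>range E \<subseteq> setsM M\<close> is vacuous if \<open>setsM M\<close> is empty.  Set variables range over
  a nonempty domain, as always in first-order logic; this is the first conjunct below.
\<close>

definition RCA0 :: "'a l2_struct \<Rightarrow> bool" where
  "RCA0 M \<longleftrightarrow> setsM M \<noteq> {} \<and> basic_axioms M \<and> Sigma01_induction M \<and> Delta01_comprehension M"

definition ACA0 :: "'a l2_struct \<Rightarrow> bool" where
  "ACA0 M \<longleftrightarrow> RCA0 M \<and> arithmetical_comprehension M"

section \<open>Graphs and Euler paths inside a structure\<close>

text \<open>The pairing function \<open>(m, n) = (m + n)\<^sup>2 + m\<close>, injective over \<open>RCA\<^sub>0\<close>.\<close>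

definition pairM :: "'a l2_struct \<Rightarrow> 'a \<Rightarrow> 'a \<Rightarrow> 'a" where
  "pairM M m n = plusM M (timesM M (plusM M m n) (plusM M m n)) m"

text \<open>The functions of the structure are those whose graph is one of its sets.\<close>

definition functionsM :: "'a l2_struct \<Rightarrow> ('a \<Rightarrow> 'a) set" where
  "functionsM M = {f. {pairM M n (f n) | n. True} \<in> setsM M}"

text \<open>
  A sequence of graphs is coded by a set \<open>VV\<close> of pairs \<open>(i, v)\<close> and a set \<open>EE\<close> of pairs
  \<open>(i, (u, v))\<close>.  Unordered pairs of (distinct) vertices are rendered by a symmetric,
  irreflexive edge relation.
\<close>

definition vertices_at :: "'a l2_struct \<Rightarrow> 'a set \<Rightarrow> 'a \<Rightarrow> 'a set" where
  "vertices_at M VV i = {v. pairM M i v \<in> VV}"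

definition edges_at :: "'a l2_struct \<Rightarrow> 'a set \<Rightarrow> 'a \<Rightarrow> ('a \<times> 'a) set" where
  "edges_at M EE i = {(u, v). pairM M i (pairM M u v) \<in> EE}"

definition is_graph :: "'a set \<Rightarrow> ('a \<times> 'a) set \<Rightarrow> bool" where
  "is_graph V E \<longleftrightarrow> E \<subseteq> V \<times> V \<and> sym E \<and> irrefl E"

definition graph_sequence :: "'a l2_struct \<Rightarrow> 'a set \<Rightarrow> 'a set \<Rightarrow> bool" where
  "graph_sequence M VV EE \<longleftrightarrow> VV \<in> setsM M \<and> EE \<in> setsM M \<and>
     (\<forall>i. is_graph (vertices_at M VV i) (edges_at M EE i))"

definition is_path :: "'a l2_struct \<Rightarrow> 'a set \<Rightarrow> ('a \<times> 'a) set \<Rightarrow> ('a \<Rightarrow> 'a) \<Rightarrow> bool" where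
  "is_path M V E f \<longleftrightarrow> f \<in> functionsM M \<and>
     (\<forall>n. f n \<in> V) \<and> (\<forall>n. (f n, f (plusM M n (oneM M))) \<in> E)"

definition is_euler_path :: "'a l2_struct \<Rightarrow> 'a set \<Rightarrow> ('a \<times> 'a) set \<Rightarrow> ('a \<Rightarrow> 'a) \<Rightarrow> bool" where
  "is_euler_path M V E f \<longleftrightarrow> is_path M V E f \<and>
     (\<forall>(u, v)\<in>E. \<exists>!n. {f n, f (plusM M n (oneM M))} = {u, v})"

definition has_euler_path :: "'a l2_struct \<Rightarrow> 'a set \<Rightarrow> ('a \<times> 'a) set \<Rightarrow> bool" where
  "has_euler_path M V E \<longleftrightarrow> (\<exists>f. is_euler_path M V E f)"

text \<open>
  Truth in \<open>M\<close> of the second-order statement: every set quantifier, including the one hidden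
  in the existence of a path, ranges over \<open>setsM M\<close>.
\<close>

definition euler_path_sets_exist :: "'a l2_struct \<Rightarrow> bool" where
  "euler_path_sets_exist M \<longleftrightarrow>
     (\<forall>VV EE. graph_sequence M VV EE \<longrightarrow>
        (\<exists>Z\<in>setsM M. \<forall>i. i \<in> Z \<longleftrightarrow>
           has_euler_path M (vertices_at M VV i) (edges_at M EE i)))"

end

theory Submission
  imports Defs
begin

text \<open>
  By comprehension, \<open>ACA\<^sub>0\<close> amounts to closure of the sets of the structure under projection.
  A projection \<open>{i. \<exists>j. (i, j) \<in> A}\<close> is read off the Euler paths of the graphs \<open>G\<^sub>i\<close> with edges
  \<open>{u, u + 1}\<close> for those \<open>u\<close> such that some \<open>j \<le> u\<close> satisfies \<open>(i, j) \<in> A\<close>: such a graph is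
  a ray or has no edge at all.

  Conversely, an Euler path exists iff there is a one-vertex trail that is \<^emph>\<open>extendable\<close>: for every
  finite set of edges it has a finite prolongation that covers them and whose end reaches all
  the remaining edges, of which there is at least one, through remaining edges. This is an
  arithmetical condition. The point is that every such prolongation is again extendable: a longer
  trail that covers it can be rearranged, by reversals of closed segments, into one that prolongs
  it, because the edges that are left stay connected to its end. No degrees or parities are
  involved. An Euler path is then the limit of a recursively constructed sequence of extendable
  trails.
\<close>

text \<open>Having an Euler path quantifies over functions, so arithmetical comprehension does not
  apply to it directly; hence the search for a condition on coded finite trails. That condition
  supplies a separate prolongation for each finite set of edges, and these need not agree, so no
  limit can be read off them. Rearrangement is what makes a chosen prolongation compatible with the
  witnesses for all larger sets. It works because the edges left over do not fall apart: an edge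
  that the other trail takes in the wrong direction lies on a loop that can be turned round.

  The structure may be nonstandard, so finite means bounded by one of its elements, and HOL lists
  and recursion cannot describe its trails. Trails, walks and finite sets are elements, coded by
  divisibility, and every induction has to be over a set of the structure.\<close>

definition pair_tm :: "tm \<Rightarrow> tm \<Rightarrow> tm" where
  "pair_tm s t = Plus (Times (Plus s t) (Plus s t)) s"

lemma tm_val_pair_tm [simp]:
  "tm_val M e (pair_tm s t) = pairM M (tm_val M e s) (tm_val M e t)"
  by (simp add: pair_tm_def pairM_def)

lemma tm_vars_pair_tm [simp]: "tm_vars (pair_tm s t) = tm_vars s \<union> tm_vars t"
  by (auto simp: pair_tm_def)

section \<open>Models of \<open>RCA0\<close> and their definable predicates\<close>

locale rca =
  fixes M :: "'a l2_struct"
  assumes RCA0: "RCA0 M"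
begin

abbreviation zero ("\<zero>") where "\<zero> \<equiv> zeroM M"
abbreviation one ("\<one>") where "\<one> \<equiv> oneM M"
abbreviation plus (infixl "\<oplus>" 65) where "x \<oplus> y \<equiv> plusM M x y"
abbreviation times (infixl "\<otimes>" 70) where "x \<otimes> y \<equiv> timesM M x y"
abbreviation less (infix "\<prec>" 50) where "x \<prec> y \<equiv> lessM M x y"
abbreviation pair where "pair \<equiv> pairM M"

definition leq (infix "\<preceq>" 50) where "x \<preceq> y \<longleftrightarrow> x \<prec> y \<or> x = y"

text \<open>Truncated subtraction completes the signature of an ordered semiring; the value zero
  below the diagonal lets \<open>minus_minus\<close> and \<open>times_minus\<close> hold without
  side conditions.\<close>

definition minus (infixl "\<ominus>" 65)
  where "x \<ominus> y = (if y \<preceq> x then THE z. z \<oplus> y = x else \<zero>)"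

text \<open>Stated for predicates, membership in \<open>setsM M\<close> can be proved by
  introduction rules that follow the shape of a formula. Several arguments are packed into one by
  \<open>pair\<close>.\<close>

definition Ar :: "('a \<Rightarrow> bool) \<Rightarrow> bool" where
  "Ar P \<longleftrightarrow> Collect P \<in> setsM M"

abbreviation Rf :: "('a \<Rightarrow> 'a) \<Rightarrow> bool" where
  "Rf f \<equiv> f \<in> functionsM M"

lemma basic [simp]:
  "n \<oplus> \<one> \<noteq> \<zero>"
  "m \<oplus> \<one> = n \<oplus> \<one> \<longleftrightarrow> m = n"
  "m \<oplus> \<zero> = m"
  "m \<otimes> \<zero> = \<zero>"
  "\<not> m \<prec> \<zero>"
  "\<zero> \<noteq> n \<oplus> \<one>"
  using RCA0 by (auto simp: RCA0_def basic_axioms_def)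

lemma basic_rec:
  "m \<oplus> (n \<oplus> \<one>) = (m \<oplus> n) \<oplus> \<one>"
  "m \<otimes> (n \<oplus> \<one>) = m \<otimes> n \<oplus> m"
  "m \<prec> n \<oplus> \<one> \<longleftrightarrow> m \<prec> n \<or> m = n"
  using RCA0 by (auto simp: RCA0_def basic_axioms_def)

text \<open>The convention for all later uses: variable 0 holds the argument, variable 1 is the
  single unbounded variable, and higher ones are bounded or hold parameters.\<close>

lemma Ar_Delta01:
  assumes "Delta00 p" "Delta00 q" "range E \<subseteq> setsM M"
    and ex: "\<And>a. P a \<longleftrightarrow> (\<exists>b. sat M (e(0 := a, 1 := b)) E p)"
    and all: "\<And>a. P a \<longleftrightarrow> (\<forall>b. sat M (e(0 := a, 1 := b)) E q)"
  shows "Ar P"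
proof -
  have "Sigma01 (Ex 1 p)" "Pi01 (All 1 q)"
    using assms(1,2) by (auto intro: Sigma01.intros Pi01.intros)
  moreover have "\<forall>a. sat M (e(0 := a)) E (Ex 1 p) \<longleftrightarrow> sat M (e(0 := a)) E (All 1 q)"
    using ex all by (metis sat.simps(8,9))
  ultimately have "{a. sat M (e(0 := a)) E (Ex 1 p)} \<in> setsM M"
    using assms(3) RCA0 unfolding RCA0_def Delta01_comprehension_def by blast
  moreover have "sat M (e(0 := a)) E (Ex 1 p) = P a" for a unfolding ex by simp
  ultimately show ?thesis by (simp only: Ar_def Collect_mono_iff)
qed

lemma Ar_Delta00:
  assumes "Delta00 p" "range E \<subseteq> setsM M"
    and "\<And>a b. sat M (e(0 := a, 1 := b)) E p \<longleftrightarrow> P a"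
  shows "Ar P"
  using assms by (intro Ar_Delta01[of p p E P e]) auto

lemma setsM_nonempty: "\<exists>A. A \<in> setsM M"
  using RCA0 by (auto simp: RCA0_def)

lemma Ar_Delta00':
  assumes "Delta00 p"
    and "\<And>a b E. sat M (e(0 := a, 1 := b)) E p \<longleftrightarrow> P a"
  shows "Ar P"
proof -
  obtain A where "A \<in> setsM M" using setsM_nonempty by blast
  then show ?thesis using assms by (intro Ar_Delta00[of p "\<lambda>_. A" e P]) auto
qed

text \<open>A vacuous quantifier over variable 1 turns membership in a set of the structure into a
  \<open>Sigma01\<close> formula. The case \<open>definable\<close> is the price of induction in a
  possibly nonstandard structure.\<close>

lemma induct_M [case_names zero succ definable]:
  assumes "P \<zero>" "\<And>n. P n \<Longrightarrow> P (n \<oplus> \<one>)" "Ar P"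
  shows "P n"
proof -
  have s: "Sigma01 (Ex 1 (Mem (Var 0) 0))" by (intro Sigma01.intros Delta00.intros)
  have "range (\<lambda>_::nat. Collect P) \<subseteq> setsM M" using assms(3) by (auto simp: Ar_def)
  moreover have sat: "sat M (e(0 := a)) (\<lambda>_. Collect P) (Ex 1 (Mem (Var 0) 0)) \<longleftrightarrow> P a" for a e
    by simp
  moreover have "Sigma01_induction M" using RCA0 by (simp add: RCA0_def)
  ultimately have "\<forall>a. sat M (e(0 := a)) (\<lambda>_. Collect P) (Ex 1 (Mem (Var 0) 0))" for e
    using s assms(1,2) unfolding Sigma01_induction_def by metis
  then show ?thesis by simp
qed

section \<open>Arithmetic\<close>

lemmas D00 = Delta00.intros

lemma zero_plus [simp]: "\<zero> \<oplus> m = m"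
proof (induction m rule: induct_M)
  case (succ n) then show ?case by (simp add: basic_rec)
qed (auto intro!: D00 Ar_Delta00'[of "Eq (Plus Zero (Var 0)) (Var 0)" "\<lambda>_. \<zero>"])

lemma succ_plus: "(m \<oplus> \<one>) \<oplus> n = (m \<oplus> n) \<oplus> \<one>"
proof (induction n rule: induct_M)
  case (succ n) then show ?case by (simp add: basic_rec)
qed (auto intro!: D00 Ar_Delta00'[of "Eq (Plus (Plus (Var 2) One) (Var 0)) (Plus (Plus (Var 2) (Var 0)) One)" "\<lambda>_. m"])

lemma plus_comm: "m \<oplus> n = n \<oplus> m"
proof (induction n rule: induct_M)
  case (succ n) then show ?case by (simp add: basic_rec succ_plus)
qed (auto intro!: D00 Ar_Delta00'[of "Eq (Plus (Var 2) (Var 0)) (Plus (Var 0) (Var 2))" "\<lambda>_. m"])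

lemma plus_assoc: "(k \<oplus> m) \<oplus> n = k \<oplus> (m \<oplus> n)"
proof (induction n rule: induct_M)
  case (succ n) then show ?case by (simp add: basic_rec)
qed (auto intro!: D00 Ar_Delta00'[of "Eq (Plus (Plus (Var 2) (Var 3)) (Var 0)) (Plus (Var 2) (Plus (Var 3) (Var 0)))" "(\<lambda>_. m)(2 := k)"])

lemma plus_left_comm: "k \<oplus> (m \<oplus> n) = m \<oplus> (k \<oplus> n)"
  by (metis plus_assoc plus_comm)

lemma zero_times [simp]: "\<zero> \<otimes> m = \<zero>"
proof (induction m rule: induct_M)
  case (succ n) then show ?case by (simp add: basic_rec)
qed (auto intro!: D00 Ar_Delta00'[of "Eq (Times Zero (Var 0)) Zero" "\<lambda>_. \<zero>"])

lemma succ_times: "(m \<oplus> \<one>) \<otimes> n = m \<otimes> n \<oplus> n"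
proof (induction n rule: induct_M)
  case (succ n) then show ?case
    by (simp add: basic_rec(2) plus_assoc plus_left_comm plus_comm[of \<one>])
qed (auto intro!: D00 Ar_Delta00'[of "Eq (Times (Plus (Var 2) One) (Var 0)) (Plus (Times (Var 2) (Var 0)) (Var 0))" "\<lambda>_. m"])

lemma times_comm: "m \<otimes> n = n \<otimes> m"
proof (induction n rule: induct_M)
  case (succ n) then show ?case by (simp add: basic_rec succ_times)
qed (auto intro!: D00 Ar_Delta00'[of "Eq (Times (Var 2) (Var 0)) (Times (Var 0) (Var 2))" "\<lambda>_. m"])

lemma times_distrib: "k \<otimes> (m \<oplus> n) = k \<otimes> m \<oplus> k \<otimes> n"
proof (induction n rule: induct_M)
  case (succ n) then show ?case by (metis basic_rec(1,2) plus_assoc)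
qed (auto intro!: D00 Ar_Delta00'[of "Eq (Times (Var 2) (Plus (Var 3) (Var 0))) (Plus (Times (Var 2) (Var 3)) (Times (Var 2) (Var 0)))" "(\<lambda>_. m)(2 := k)"])

lemma times_assoc: "(k \<otimes> m) \<otimes> n = k \<otimes> (m \<otimes> n)"
proof (induction n rule: induct_M)
  case (succ n) then show ?case by (simp add: basic_rec(2) times_distrib[of k "m \<otimes> n" m])
qed (auto intro!: D00 Ar_Delta00'[of "Eq (Times (Times (Var 2) (Var 3)) (Var 0)) (Times (Var 2) (Times (Var 3) (Var 0)))" "(\<lambda>_. m)(2 := k)"])

lemma plus_cancel: "m \<oplus> k = n \<oplus> k \<longleftrightarrow> m = n"
proof (induction k rule: induct_M)
  case (succ n) then show ?case by (simp add: basic_rec)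
qed (auto intro!: D00 Ar_Delta00'[of "Or (And (Eq (Plus (Var 2) (Var 0)) (Plus (Var 3) (Var 0))) (Eq (Var 2) (Var 3)))
   (And (Neg (Eq (Plus (Var 2) (Var 0)) (Plus (Var 3) (Var 0)))) (Neg (Eq (Var 2) (Var 3))))" "(\<lambda>_. n)(2 := m)"])

lemma zero_least: "\<zero> = m \<or> \<zero> \<prec> m"
proof (induction m rule: induct_M)
  case (succ n) then show ?case by (auto simp: basic_rec)
qed (auto intro!: D00 Ar_Delta00'[of "Or (Eq Zero (Var 0)) (Less Zero (Var 0))" "\<lambda>_. \<zero>"])

lemma nonzero_succ: "m = \<zero> \<or> (\<exists>k. k \<prec> m \<and> m = k \<oplus> \<one>)"
proof (induction m rule: induct_M)
  case (succ n) then show ?case by (auto simp: basic_rec)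
qed (auto intro!: D00 Ar_Delta00'[of "Or (Eq (Var 0) Zero) (Ex 2 (And (Less (Var 2) (Var 0)) (Eq (Var 0) (Plus (Var 2) One))))" "\<lambda>_. \<zero>"])

lemma less_plus: "m \<prec> m \<oplus> (k \<oplus> \<one>)"
proof (induction k rule: induct_M)
  case zero then show ?case using basic_rec(3) by auto
next
  case (succ n) then show ?case by (simp add: basic_rec)
qed (auto intro!: D00 Ar_Delta00'[of "Less (Var 2) (Plus (Var 2) (Plus (Var 0) One))" "\<lambda>_. m"])

text \<open>The bound on \<open>k\<close> only serves to make the induction formula \<open>\<Delta>\<^sup>0\<^sub>0\<close>.\<close>

lemma less_imp_plus: "m \<prec> n \<longrightarrow> (\<exists>k. k \<prec> n \<and> n = m \<oplus> (k \<oplus> \<one>))"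
proof (induction n rule: induct_M)
  case (succ n)
  show ?case
  proof
    assume "m \<prec> n \<oplus> \<one>"
    then consider "m \<prec> n" | "m = n" by (auto simp: basic_rec)
    then show "\<exists>k. k \<prec> n \<oplus> \<one> \<and> n \<oplus> \<one> = m \<oplus> (k \<oplus> \<one>)"
    proof cases
      case 1
      then obtain k where k: "n = m \<oplus> (k \<oplus> \<one>)" using succ by blast
      have "k \<oplus> \<one> \<prec> n \<oplus> \<one>"
        using k less_plus[of "k \<oplus> \<one>" m] by (metis plus_comm basic_rec(1))
      then show ?thesis using k by (metis basic_rec(1))
    next
      case 2
      then show ?thesis using zero_least[of "n \<oplus> \<one>"] by (intro exI[of _ \<zero>]) (auto simp: basic_rec(1))
    qed
  qed
qed (auto intro!: D00 Ar_Delta00'[of "Imp (Less (Var 2) (Var 0)) (Ex 3 (And (Less (Var 3) (Var 0)) (Eq (Var 0) (Plus (Var 2) (Plus (Var 3) One)))))" "\<lambda>_. m"])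

lemma less_iff: "m \<prec> n \<longleftrightarrow> (\<exists>k. n = m \<oplus> (k \<oplus> \<one>))"
  using less_plus less_imp_plus by blast

lemma leq_iff: "m \<preceq> n \<longleftrightarrow> (\<exists>k. n = m \<oplus> k)"
  unfolding leq_def less_iff by (metis basic(3) nonzero_succ)

lemma less_irrefl: "\<not> m \<prec> m"
  unfolding less_iff by (metis basic(1,3) plus_cancel plus_comm)

lemma less_trans: "k \<prec> m \<Longrightarrow> m \<prec> n \<Longrightarrow> k \<prec> n"
  unfolding less_iff by (metis plus_assoc)

lemma less_linear: "m \<prec> n \<or> m = n \<or> n \<prec> m"
proof (induction n rule: induct_M)
  case zero then show ?case using zero_least by metis
next
  case (succ n)
  then show ?case
    by (smt (verit) basic_rec less_iff nonzero_succ plus_assoc plus_comm basic(3))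
qed (auto intro!: D00 Ar_Delta00'[of "Or (Less (Var 2) (Var 0)) (Or (Eq (Var 2) (Var 0)) (Less (Var 0) (Var 2)))" "\<lambda>_. m"])

lemma minus_plus: "y \<preceq> x \<Longrightarrow> (x \<ominus> y) \<oplus> y = x"
proof -
  assume a: "y \<preceq> x"
  then obtain k where k: "k \<oplus> y = x" using leq_iff plus_comm by metis
  then have "(THE z. z \<oplus> y = x) = k" by (intro the_equality) (auto simp: plus_cancel)
  with a k show ?thesis by (simp add: minus_def)
qed

lemma plus_minus: "(x \<oplus> y) \<ominus> y = x"
  using minus_plus[of y "x \<oplus> y"] plus_cancel leq_iff[of y "x \<oplus> y"] by (metis plus_comm)

lemma times_one: "\<one> \<otimes> x = x"
  by (metis basic(4) basic_rec(2) times_comm zero_plus)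

lemma one_nonzero: "\<zero> \<noteq> \<one>"
  by (metis basic(1) zero_plus)

lemma times_pos: "\<zero> \<prec> x \<Longrightarrow> \<zero> \<prec> y \<Longrightarrow> \<zero> \<prec> x \<otimes> y"
  by (metis basic(1) basic(3) basic_rec(1,2) nonzero_succ zero_least less_irrefl)

lemma times_less: "x \<prec> y \<Longrightarrow> \<zero> \<prec> z \<Longrightarrow> z \<otimes> x \<prec> z \<otimes> y"
proof -
  assume a: "x \<prec> y" "\<zero> \<prec> z"
  then obtain k where k: "y = x \<oplus> (k \<oplus> \<one>)" by (auto simp: less_iff)
  have "\<zero> \<prec> z \<otimes> (k \<oplus> \<one>)" using a(2) zero_least[of "k \<oplus> \<one>"] by (intro times_pos) auto
  then obtain l where "z \<otimes> (k \<oplus> \<one>) = l \<oplus> \<one>" by (auto simp: less_iff)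
  then show ?thesis by (auto simp: k times_distrib less_iff)
qed

lemma minus_minus: "a \<ominus> b \<ominus> c = a \<ominus> (b \<oplus> c)"
proof (cases "b \<oplus> c \<preceq> a")
  case True
  then obtain k where k: "a = (b \<oplus> c) \<oplus> k" using leq_iff by blast
  have "a = k \<oplus> (b \<oplus> c)" "a = (k \<oplus> c) \<oplus> b" by (metis k plus_assoc plus_comm)+
  then show ?thesis by (metis plus_minus)
next
  case False
  show ?thesis
  proof (cases "b \<preceq> a")
    case True
    then obtain k where k: "a = k \<oplus> b" using leq_iff plus_comm by metis
    have "\<not> c \<preceq> k" using False k leq_iff by (metis plus_assoc plus_comm)
    then show ?thesis using False k plus_minus by (simp add: minus_def)
  next
    case b: False
    have "\<zero> \<ominus> c = \<zero>"
      by (metis basic(3) leq_def minus_def minus_plus basic(5))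
    then show ?thesis using False b by (simp add: minus_def)
  qed
qed

lemma times_minus: "a \<otimes> (b \<ominus> c) = a \<otimes> b \<ominus> a \<otimes> c"
proof (cases "c \<preceq> b")
  case True
  then obtain k where k: "b = k \<oplus> c" using leq_iff plus_comm by metis
  then show ?thesis by (simp add: plus_minus times_distrib)
next
  case False
  then have bc: "b \<prec> c" using less_linear leq_def by blast
  show ?thesis
  proof (cases "a = \<zero>")
    case True then show ?thesis by (simp add: plus_minus[of \<zero> \<zero>, simplified])
  next
    case az: False
    then have "a \<otimes> b \<prec> a \<otimes> c" using bc times_less zero_least by metis
    then have "\<not> a \<otimes> c \<preceq> a \<otimes> b" using less_irrefl less_trans leq_def by metis
    with False show ?thesis by (simp add: minus_def)
  qed
qed

text \<open>From here on the library of ordered semirings and the method \<open>order\<close> are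
  available for the elements of the structure.\<close>

sublocale N: linordered_semidom where plus = "(\<oplus>)" and minus = "(\<ominus>)" and zero = "\<zero>"
  and one = "\<one>" and times = "(\<otimes>)" and less_eq = "(\<preceq>)" and less = "(\<prec>)"
proof
  fix a b c
  show "a \<oplus> b \<oplus> c = a \<oplus> (b \<oplus> c)" by (rule plus_assoc)
  show "a \<oplus> b = b \<oplus> a" by (rule plus_comm)
  show "\<zero> \<oplus> a = a" by simp
  show "a \<oplus> b \<ominus> a = b" by (metis plus_minus plus_comm)
  show "a \<ominus> b \<ominus> c = a \<ominus> (b \<oplus> c)" by (rule minus_minus)
  show "a \<otimes> b \<otimes> c = a \<otimes> (b \<otimes> c)" by (rule times_assoc)
  show "a \<otimes> b = b \<otimes> a" by (rule times_comm)
  show "\<one> \<otimes> a = a" by (rule times_one)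
  show "(a \<oplus> b) \<otimes> c = a \<otimes> c \<oplus> b \<otimes> c" by (metis times_distrib times_comm)
  show "a \<otimes> (b \<oplus> c) = a \<otimes> b \<oplus> a \<otimes> c" by (rule times_distrib)
  show "\<zero> \<otimes> a = \<zero>" by simp
  show "a \<otimes> \<zero> = \<zero>" by simp
  show "\<zero> \<noteq> \<one>" by (rule one_nonzero)
  show "a \<otimes> (b \<ominus> c) = a \<otimes> b \<ominus> a \<otimes> c" by (rule times_minus)
  show "\<zero> \<prec> \<one>" using zero_least one_nonzero by blast
  show "a \<prec> b \<longleftrightarrow> a \<preceq> b \<and> \<not> b \<preceq> a" using less_trans less_irrefl leq_def by metis
  show "a \<preceq> a" by (simp add: leq_def)
  show "a \<preceq> b \<Longrightarrow> b \<preceq> c \<Longrightarrow> a \<preceq> c" using less_trans leq_def by metis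
  show "a \<preceq> b \<Longrightarrow> b \<preceq> a \<Longrightarrow> a = b" using less_trans less_irrefl leq_def by metis
  show "a \<preceq> b \<or> b \<preceq> a" using less_linear leq_def by metis
  show "a \<preceq> b \<Longrightarrow> c \<oplus> a \<preceq> c \<oplus> b" by (auto simp: leq_iff plus_assoc)
  show "a \<preceq> b \<Longrightarrow> b \<ominus> a \<oplus> a = b" by (rule minus_plus)
  show "a \<prec> b \<Longrightarrow> \<zero> \<prec> c \<Longrightarrow> c \<otimes> a \<prec> c \<otimes> b" by (rule times_less)
  show "a \<noteq> \<zero> \<Longrightarrow> b \<noteq> \<zero> \<Longrightarrow> a \<otimes> b \<noteq> \<zero>" using times_pos zero_least less_irrefl by metis
qed

lemma less_succ: "m \<prec> n \<oplus> \<one> \<longleftrightarrow> m \<preceq> n" by (simp add: leq_def basic_rec)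
lemma less_leq_succ: "m \<prec> n \<longleftrightarrow> m \<oplus> \<one> \<preceq> n"
  by (metis N.add_less_cancel_right less_succ N.less_add_one N.le_less_trans N.less_le_trans N.not_le)
lemma zero_leq [simp]: "\<zero> \<preceq> m" using zero_least leq_def by metis

section \<open>Pairs\<close>

text \<open>With \<open>s = m \<oplus> n\<close>, the code lies between \<open>s \<otimes> s\<close>
  and \<open>s \<otimes> s \<oplus> s\<close>, below the square of the successor of
  \<open>s\<close>: different sums occupy disjoint blocks.\<close>

lemma pair_mono:
  assumes "m \<oplus> n \<prec> m' \<oplus> n'"
  shows "pair m n \<prec> pair m' n'"
proof -
  define s s' where "s = m \<oplus> n" "s' = m' \<oplus> n'"
  have "s \<oplus> \<one> \<preceq> s'" using assms by (simp add: s_s'_def less_leq_succ)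
  then have "(s \<oplus> \<one>) \<otimes> (s \<oplus> \<one>) \<preceq> s' \<otimes> s'" by (intro N.mult_mono) auto
  moreover have "m \<preceq> s" unfolding s_s'_def by simp
  moreover have "(s \<oplus> \<one>) \<otimes> (s \<oplus> \<one>) = s \<otimes> s \<oplus> s \<oplus> (s \<oplus> \<one>)"
    by (simp add: N.distrib_left N.distrib_right N.add.assoc N.add.left_commute N.add.commute)
  moreover have "m \<prec> s \<oplus> (s \<oplus> \<one>)"
    using \<open>m \<preceq> s\<close> by (metis N.le_less_trans less_plus)
  then have "s \<otimes> s \<oplus> m \<prec> s \<otimes> s \<oplus> s \<oplus> (s \<oplus> \<one>)"
    by (simp add: N.add.assoc)
  moreover have "s' \<otimes> s' \<preceq> s' \<otimes> s' \<oplus> m'" by simp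
  ultimately show ?thesis unfolding pairM_def s_s'_def[symmetric]
    by (metis N.less_le_trans)
qed

lemma pair_eq_iff [simp]: "pair m n = pair m' n' \<longleftrightarrow> m = m' \<and> n = n'"
proof
  assume e: "pair m n = pair m' n'"
  then have s: "m \<oplus> n = m' \<oplus> n'" using pair_mono by (metis N.less_irrefl N.neqE)
  then have "m = m'" using e by (simp add: pairM_def)
  with s show "m = m' \<and> n = n'" by simp
qed simp

lemma leq_pair [simp]: "m \<preceq> pair m n" "n \<preceq> pair m n"
proof -
  show "m \<preceq> pair m n" by (simp add: pairM_def)
  have "x \<preceq> x \<otimes> x" for x
    by (metis N.mult_1 N.mult_right_mono basic(4) less_leq_succ zero_least zero_leq zero_plus)
  then have "m \<oplus> n \<preceq> pair m n"
    by (metis N.add_increasing2 pairM_def zero_leq)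
  moreover have "n \<preceq> m \<oplus> n" by simp
  ultimately show "n \<preceq> pair m n" by order
qed

text \<open>Pairing is not surjective; the value zero elsewhere makes the projections total, so that
  any element can be read as a tuple.\<close>

definition p1 where "p1 c = (if \<exists>m n. c = pair m n then THE m. \<exists>n. c = pair m n else \<zero>)"
definition p2 where "p2 c = (if \<exists>m n. c = pair m n then THE n. \<exists>m. c = pair m n else \<zero>)"

lemma p1_pair [simp]: "p1 (pair m n) = m" by (auto simp: p1_def)
lemma p2_pair [simp]: "p2 (pair m n) = n" by (auto simp: p2_def)

section \<open>Closure under relative recursiveness\<close>

abbreviation graph_of where "graph_of f \<equiv> {pair n (f n) |n. True}"

lemma Rf_iff: "Rf f \<longleftrightarrow> graph_of f \<in> setsM M"
  by (simp add: functionsM_def)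

lemma Rf_Ar: "Rf f \<longleftrightarrow> Ar (\<lambda>z. \<exists>n. z = pair n (f n))"
  by (simp add: Rf_iff Ar_def)

lemma Ar_const: "Ar (\<lambda>_. P)"
  by (cases P) (auto intro!: D00 Ar_Delta00'[of "Eq Zero (if P then Zero else One)" "\<lambda>_. \<zero>"])

lemma Ar_not: "Ar P \<Longrightarrow> Ar (\<lambda>c. \<not> P c)"
  by (intro Ar_Delta00[of "Neg (Mem (Var 0) 0)" "\<lambda>_. Collect P" "\<lambda>_. \<zero>"] D00) (auto simp: Ar_def)

lemma Ar_and: "Ar P \<Longrightarrow> Ar Q \<Longrightarrow> Ar (\<lambda>c. P c \<and> Q c)"
  by (intro Ar_Delta00[of "And (Mem (Var 0) 0) (Mem (Var 0) 1)" "(\<lambda>_. Collect P)(1 := Collect Q)" "\<lambda>_. \<zero>"] D00)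
    (auto simp: Ar_def)

lemma Ar_or: "Ar P \<Longrightarrow> Ar Q \<Longrightarrow> Ar (\<lambda>c. P c \<or> Q c)"
  using Ar_not[OF Ar_and[OF Ar_not Ar_not, of P Q]] by simp

lemma Ar_imp: "Ar P \<Longrightarrow> Ar Q \<Longrightarrow> Ar (\<lambda>c. P c \<longrightarrow> Q c)"
  unfolding imp_conv_disj by (intro Ar_or Ar_not)

lemma Ar_iff: "Ar P \<Longrightarrow> Ar Q \<Longrightarrow> Ar (\<lambda>c. P c \<longleftrightarrow> Q c)"
  unfolding iff_conv_conj_imp by (intro Ar_and Ar_imp)

text \<open>Variable 0 holds a pair, whose components are moved to variables 2 and 3.\<close>

definition unpair_fm :: "fm \<Rightarrow> fm" where
  "unpair_fm p = Ex 2 (And (Less (Var 2) (Plus (Var 0) One)) (Ex 3 (And (Less (Var 3) (Plus (Var 0) One))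
     (And (Eq (Var 0) (pair_tm (Var 2) (Var 3))) p))))"

lemma Delta00_unpair: "Delta00 p \<Longrightarrow> Delta00 (unpair_fm p)"
  unfolding unpair_fm_def by (intro D00) auto

lemma sat_unpair:
  "sat M e E (unpair_fm p) \<longleftrightarrow> (\<exists>n m. e 0 = pair n m \<and> sat M (e(2 := n, 3 := m)) E p)"
  unfolding unpair_fm_def by (auto simp: less_succ)

lemma Rf_Delta01:
  assumes p: "Delta00 p" and q: "Delta00 q" and E: "range E \<subseteq> setsM M"
    and ex: "\<And>n m. m = f n \<longleftrightarrow> (\<exists>b. sat M (e(0 := pair n m, 1 := b, 2 := n, 3 := m)) E p)"
    and all: "\<And>n m. m = f n \<longleftrightarrow> (\<forall>b. sat M (e(0 := pair n m, 1 := b, 2 := n, 3 := m)) E q)"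
  shows "Rf f"
  unfolding Rf_Ar
proof (rule Ar_Delta01[OF Delta00_unpair[OF p] Delta00_unpair[OF q] E, of _ e])
  fix a
  have *: "(\<exists>n. a = pair n (f n)) \<longleftrightarrow> (\<exists>n m. a = pair n m \<and> m = f n)" by blast
  show "(\<exists>n. a = pair n (f n)) \<longleftrightarrow> (\<exists>b. sat M (e(0 := a, 1 := b)) E (unpair_fm p))"
    unfolding * ex sat_unpair by auto
  \<comment> \<open>The quantifier over \<open>b\<close> moves past the one over components because
    a pair determines them; if \<open>a\<close> is no pair, both sides fail.\<close>
  show "(\<exists>n. a = pair n (f n)) \<longleftrightarrow> (\<forall>b. sat M (e(0 := a, 1 := b)) E (unpair_fm q))"
    unfolding * all sat_unpair by (cases "\<exists>n m. a = pair n m") auto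
qed

lemma Rf_Delta00:
  assumes p: "Delta00 p"
    and sat: "\<And>n m b E. sat M (e(0 := pair n m, 1 := b, 2 := n, 3 := m)) E p \<longleftrightarrow> m = f n"
  shows "Rf f"
proof -
  obtain A where "A \<in> setsM M" using setsM_nonempty by blast
  then show ?thesis using sat by (intro Rf_Delta01[OF p p, of "\<lambda>_. A"]) auto
qed

lemma Rf_id: "Rf (\<lambda>c. c)"
  by (rule Rf_Delta00[of "Eq (Var 2) (Var 3)"]) (auto intro: D00)

lemma Rf_const: "Rf (\<lambda>c. a)"
  by (rule Rf_Delta00[of "Eq (Var 3) (Var 4)" "\<lambda>_. a"]) (auto intro: D00)

text \<open>The intermediate value is unique, so it may be bound by an existential or by a universal
  quantifier; these are the two forms that comprehension asks for. \<open>Ar_comp\<close> and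
  \<open>Ar_bex\<close> use the same device.\<close>

lemma Rf_comp:
  assumes h: "Rf h" and f: "Rf f"
  shows "Rf (\<lambda>c. h (f c))"
proof (rule Rf_Delta01[of
      "And (Mem (pair_tm (Var 2) (Var 1)) 0) (Mem (pair_tm (Var 1) (Var 3)) 1)"
      "Imp (Mem (pair_tm (Var 2) (Var 1)) 0) (Mem (pair_tm (Var 1) (Var 3)) 1)"
      "(\<lambda>_. graph_of f)(1 := graph_of h)" _ "\<lambda>_. \<zero>"])
  show "range ((\<lambda>_. graph_of f)(1 := graph_of h)) \<subseteq> setsM M"
    using assms by (auto simp: Rf_iff)
qed (auto intro!: D00)

text \<open>There are two intermediate values but only one unbounded variable. It serves as a common
  bound for both.\<close>

lemma Rf_binary:
  assumes t: "\<And>e. tm_val M e t = h (e 4) (e 5)" and f: "Rf f" and g: "Rf g"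
  shows "Rf (\<lambda>c. h (f c) (g c))"
proof -
  have b: "\<exists>w. f c \<prec> w \<and> g c \<prec> w" for c
    by (rule exI[of _ "f c \<oplus> g c \<oplus> \<one>"]) (auto simp: less_succ)
  show ?thesis
proof (rule Rf_Delta01[of
      "Ex 4 (And (Less (Var 4) (Var 1)) (Ex 5 (And (Less (Var 5) (Var 1))
         (And (And (Mem (pair_tm (Var 2) (Var 4)) 0) (Mem (pair_tm (Var 2) (Var 5)) 1))
           (Eq (Var 3) t)))))"
      "All 4 (Imp (Less (Var 4) (Var 1)) (All 5 (Imp (Less (Var 5) (Var 1))
         (Imp (And (Mem (pair_tm (Var 2) (Var 4)) 0) (Mem (pair_tm (Var 2) (Var 5)) 1))
           (Eq (Var 3) t)))))"
      "(\<lambda>_. graph_of f)(1 := graph_of g)" _ "\<lambda>_. \<zero>"])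
  show "range ((\<lambda>_. graph_of f)(1 := graph_of g)) \<subseteq> setsM M"
    using assms by (auto simp: Rf_iff)
qed (use b in \<open>auto intro!: D00 simp: t\<close>)
qed

lemma Rf_plus: "Rf f \<Longrightarrow> Rf g \<Longrightarrow> Rf (\<lambda>c. f c \<oplus> g c)"
  by (rule Rf_binary[of "Plus (Var 4) (Var 5)"]) simp_all

lemma Rf_times: "Rf f \<Longrightarrow> Rf g \<Longrightarrow> Rf (\<lambda>c. f c \<otimes> g c)"
  by (rule Rf_binary[of "Times (Var 4) (Var 5)"]) simp_all

lemma Rf_pair: "Rf f \<Longrightarrow> Rf g \<Longrightarrow> Rf (\<lambda>c. pair (f c) (g c))"
  by (rule Rf_binary[of "pair_tm (Var 4) (Var 5)"]) simp_all

lemma Ar_comp: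
  assumes P: "Ar P" and f: "Rf f"
  shows "Ar (\<lambda>c. P (f c))"
proof (intro Ar_Delta01[of
      "And (Mem (pair_tm (Var 0) (Var 1)) 0) (Mem (Var 1) 1)"
      "Imp (Mem (pair_tm (Var 0) (Var 1)) 0) (Mem (Var 1) 1)"
      "(\<lambda>_. graph_of f)(1 := Collect P)" _ "\<lambda>_. \<zero>"] D00)
  show "range ((\<lambda>_. graph_of f)(1 := Collect P)) \<subseteq> setsM M"
    using assms by (auto simp: Rf_iff Ar_def)
qed auto

lemma Ar_less:
  assumes f: "Rf f" and g: "Rf g"
  shows "Ar (\<lambda>c. f c \<prec> g c)"
proof -
  have "Ar (\<lambda>z. \<exists>n m. z = pair n m \<and> n \<prec> m)"
  proof (intro Ar_Delta00'[of "Ex 2 (And (Less (Var 2) (Plus (Var 0) One)) (Ex 3 (And (Less (Var 3) (Plus (Var 0) One))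
        (And (Eq (Var 0) (pair_tm (Var 2) (Var 3))) (Less (Var 2) (Var 3))))))" "\<lambda>_. \<zero>"] D00)
  qed (auto simp: less_succ)
  from Ar_comp[OF this Rf_pair[OF f g]] show ?thesis by simp
qed

lemma Ar_eq:
  assumes f: "Rf f" and g: "Rf g"
  shows "Ar (\<lambda>c. f c = g c)"
  using Ar_and[OF Ar_not[OF Ar_less[OF f g]] Ar_not[OF Ar_less[OF g f]]]
  by (rule back_subst[of Ar]) (auto simp: fun_eq_iff intro: N.order_antisym)

lemma Ar_leq: "Rf f \<Longrightarrow> Rf g \<Longrightarrow> Ar (\<lambda>c. f c \<preceq> g c)"
  unfolding leq_def by (intro Ar_or Ar_less Ar_eq)

lemma Rf_p1': "Rf p1"
proof (rule Rf_Delta00[of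
      "Or (Ex 4 (And (Less (Var 4) (Plus (Var 2) One)) (Eq (Var 2) (pair_tm (Var 3) (Var 4)))))
         (And (Eq (Var 3) Zero) (All 4 (Imp (Less (Var 4) (Plus (Var 2) One))
            (All 5 (Imp (Less (Var 5) (Plus (Var 2) One)) (Neg (Eq (Var 2) (pair_tm (Var 4) (Var 5)))))))))"
      "\<lambda>_. \<zero>"])
  show "sat M ((\<lambda>_. \<zero>)(0 := pair n m, 1 := b, 2 := n, 3 := m)) E
     (Or (Ex 4 (And (Less (Var 4) (Plus (Var 2) One)) (Eq (Var 2) (pair_tm (Var 3) (Var 4)))))
         (And (Eq (Var 3) Zero) (All 4 (Imp (Less (Var 4) (Plus (Var 2) One))
            (All 5 (Imp (Less (Var 5) (Plus (Var 2) One)) (Neg (Eq (Var 2) (pair_tm (Var 4) (Var 5))))))))))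
      \<longleftrightarrow> m = p1 n" for n m b E
    by (cases "\<exists>i j. n = pair i j") (auto simp: less_succ p1_def, (metis leq_pair)+)
qed (auto intro!: D00)

lemma Rf_p2': "Rf p2"
proof (rule Rf_Delta00[of
      "Or (Ex 4 (And (Less (Var 4) (Plus (Var 2) One)) (Eq (Var 2) (pair_tm (Var 4) (Var 3)))))
         (And (Eq (Var 3) Zero) (All 4 (Imp (Less (Var 4) (Plus (Var 2) One))
            (All 5 (Imp (Less (Var 5) (Plus (Var 2) One)) (Neg (Eq (Var 2) (pair_tm (Var 4) (Var 5)))))))))"
      "\<lambda>_. \<zero>"])
  show "sat M ((\<lambda>_. \<zero>)(0 := pair n m, 1 := b, 2 := n, 3 := m)) E
     (Or (Ex 4 (And (Less (Var 4) (Plus (Var 2) One)) (Eq (Var 2) (pair_tm (Var 4) (Var 3)))))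
         (And (Eq (Var 3) Zero) (All 4 (Imp (Less (Var 4) (Plus (Var 2) One))
            (All 5 (Imp (Less (Var 5) (Plus (Var 2) One)) (Neg (Eq (Var 2) (pair_tm (Var 4) (Var 5))))))))))
      \<longleftrightarrow> m = p2 n" for n m b E
    by (cases "\<exists>i j. n = pair i j") (auto simp: less_succ p2_def, (metis leq_pair)+)
qed (auto intro!: D00)

lemmas Rf_p1 = Rf_comp[OF Rf_p1']
lemmas Rf_p2 = Rf_comp[OF Rf_p2']

lemma RfI:
  assumes "Ar (\<lambda>z. p2 z = f (p1 z))"
  shows "Rf f"
proof -
  have "Ar (\<lambda>z. z = pair (p1 z) (p2 z) \<and> p2 z = f (p1 z))"
    by (intro Ar_and assms Ar_eq Rf_pair Rf_p1 Rf_p2 Rf_id)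
  then show ?thesis unfolding Rf_Ar
    by (rule back_subst[of Ar]) (rule ext, metis p1_pair p2_pair)
qed

lemma Rf_if:
  assumes "Ar P" "Rf f" "Rf g"
  shows "Rf (\<lambda>c. if P c then f c else g c)"
proof (rule RfI)
  have "Ar (\<lambda>z. (P (p1 z) \<longrightarrow> p2 z = f (p1 z)) \<and> (\<not> P (p1 z) \<longrightarrow> p2 z = g (p1 z)))"
    by (intro Ar_and Ar_imp Ar_not Ar_eq Rf_p1 Rf_p2 Rf_id Ar_comp[OF assms(1)] Rf_comp[OF assms(2)] Rf_comp[OF assms(3)])
  then show "Ar (\<lambda>z. p2 z = (if P (p1 z) then f (p1 z) else g (p1 z)))"
    by (rule back_subst[of Ar]) auto
qed

lemma Ar_binary:
  assumes "Ar (\<lambda>z. P (p1 z) (p2 z))" "Rf f" "Rf g"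
  shows "Ar (\<lambda>c. P (f c) (g c))"
  using Ar_comp[OF assms(1) Rf_pair[OF assms(2,3)]] by simp

lemma Rf_binary_comp:
  assumes "Rf (\<lambda>z. h (p1 z) (p2 z))" "Rf f" "Rf g"
  shows "Rf (\<lambda>c. h (f c) (g c))"
  using Rf_comp[OF assms(1) Rf_pair[OF assms(2,3)]] by simp

lemma Ar_bex:
  assumes P: "Ar (\<lambda>z. P (p1 z) (p2 z))" and f: "Rf f"
  shows "Ar (\<lambda>c. \<exists>a. a \<prec> f c \<and> P c a)"
proof (intro Ar_Delta01[of
      "And (Mem (pair_tm (Var 0) (Var 1)) 0) (Ex 2 (And (Less (Var 2) (Var 1)) (Mem (pair_tm (Var 0) (Var 2)) 1)))"
      "Imp (Mem (pair_tm (Var 0) (Var 1)) 0) (Ex 2 (And (Less (Var 2) (Var 1)) (Mem (pair_tm (Var 0) (Var 2)) 1)))"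
      "(\<lambda>_. graph_of f)(1 := {z. P (p1 z) (p2 z)})" _ "\<lambda>_. \<zero>"] D00)
  show "range ((\<lambda>_. graph_of f)(1 := {z. P (p1 z) (p2 z)})) \<subseteq> setsM M"
    using assms by (auto simp: Rf_iff Ar_def)
qed auto

lemma Ar_ball:
  assumes P: "Ar (\<lambda>z. P (p1 z) (p2 z))" and f: "Rf f"
  shows "Ar (\<lambda>c. \<forall>a. a \<prec> f c \<longrightarrow> P c a)"
proof -
  have "Ar (\<lambda>c. \<not> (\<exists>a. a \<prec> f c \<and> \<not> P c a))"
    by (intro Ar_not Ar_bex assms)
  then show ?thesis by simp
qed

lemma Ar_mem: "A \<in> setsM M \<Longrightarrow> Rf f \<Longrightarrow> Ar (\<lambda>c. f c \<in> A)"
  by (rule Ar_comp[of "\<lambda>c. c \<in> A"]) (simp_all add: Ar_def)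

text \<open>Repeated \<open>intro\<close> with these rules checks definability along the syntax of a
  predicate. At this stage only bounded quantifiers are covered.\<close>

lemmas Ar_intros = Ar_const Ar_not Ar_and Ar_or Ar_imp Ar_iff Ar_less Ar_eq Ar_leq Ar_bex Ar_ball
  Ar_mem Rf_const Rf_id Rf_p1 Rf_p2 Rf_pair Rf_plus Rf_times Rf_if

text \<open>Induction is applied to the statement that nothing below \<open>c\<close> satisfies
  \<open>P\<close>.\<close>

lemma least_M:
  assumes "Ar P" "P a"
  shows "\<exists>a. P a \<and> (\<forall>b. b \<prec> a \<longrightarrow> \<not> P b)"
proof (rule ccontr)
  assume n: "\<not> ?thesis"
  have "\<forall>b. b \<prec> c \<longrightarrow> \<not> P b" for c
  proof (induction c rule: induct_M)
    case definable
    show ?case by (intro Ar_intros Ar_comp[OF assms(1)])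
  next
    case (succ c) then show ?case using n by (auto simp: less_succ leq_def)
  qed auto
  then show False using assms(2) N.less_add_one by blast
qed

section \<open>Arithmetical comprehension as closure under projection\<close>

definition projection_closed :: bool where
  "projection_closed \<longleftrightarrow> (\<forall>P. Ar P \<longrightarrow> Ar (\<lambda>c. \<exists>a. P (pair c a)))"

lemma ACA0_imp_projection_closed:
  assumes "ACA0 M"
  shows projection_closed
  unfolding projection_closed_def
proof (intro allI impI)
  fix P assume "Ar P"
  then have "range (\<lambda>_::nat. Collect P) \<subseteq> setsM M" by (auto simp: Ar_def)
  moreover have "arithmetical (Ex 1 (Mem (pair_tm (Var 0) (Var 1)) 0))" by simp
  moreover have "arithmetical_comprehension M" using assms by (simp add: ACA0_def)
  ultimately have "{a. sat M ((\<lambda>_. \<zero>)(0 := a)) (\<lambda>_. Collect P) (Ex 1 (Mem (pair_tm (Var 0) (Var 1)) 0))} \<in> setsM M"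
    unfolding arithmetical_comprehension_def by blast
  then show "Ar (\<lambda>c. \<exists>a. P (pair c a))" by (simp add: Ar_def)
qed

lemma Ar_ex:
  assumes "projection_closed" "Ar (\<lambda>z. P (p1 z) (p2 z))"
  shows "Ar (\<lambda>c. \<exists>a. P c a)"
  using assms(1)[unfolded projection_closed_def, rule_format, OF assms(2)] by simp

lemma Ar_all:
  assumes "projection_closed" "Ar (\<lambda>z. P (p1 z) (p2 z))"
  shows "Ar (\<lambda>c. \<forall>a. P c a)"
proof -
  have "Ar (\<lambda>c. \<not> (\<exists>a. \<not> P c a))" by (intro Ar_not Ar_ex assms)
  then show ?thesis by simp
qed

lemma Rf_tm_val:
  assumes "\<And>k. Rf (g k)"
  shows "Rf (\<lambda>c. tm_val M (\<lambda>k. g k c) t)"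
  by (induction t) (simp_all add: assms Rf_const Rf_plus Rf_times)

text \<open>Evaluating the number variables by functions of the structure, instead of by elements,
  makes the quantifier step of the induction an application of projection.\<close>

lemma Ar_sat:
  assumes "projection_closed" "arithmetical p" "range E \<subseteq> setsM M" "\<And>k. Rf (g k)"
  shows "Ar (\<lambda>c. sat M (\<lambda>k. g k c) E p)"
  using assms(2,4)
proof (induction p arbitrary: g)
  case (Mem t X)
  then show ?case using assms(3) by (auto intro!: Ar_mem Rf_tm_val)
next
  case (All x p)
  \<comment> \<open>The quantified variable reads the second component of a pair, all others read
    the first.\<close>
  define h where "h k = (\<lambda>z. if k = x then p2 z else g k (p1 z))" for k
  have "Rf (h k)" for k
    unfolding h_def by (intro Rf_if Ar_const Rf_p1 Rf_p2 Rf_id Rf_comp[OF All.prems(2)])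
  then have "Ar (\<lambda>z. sat M (\<lambda>k. h k z) E p)" using All by simp
  moreover have "(\<lambda>k. h k z) = (\<lambda>k. g k (p1 z))(x := p2 z)" for z
    by (auto simp: h_def)
  ultimately show ?case by (simp add: Ar_all[OF assms(1)])
next
  case (Ex x p)
  define h where "h k = (\<lambda>z. if k = x then p2 z else g k (p1 z))" for k
  have "Rf (h k)" for k
    unfolding h_def by (intro Rf_if Ar_const Rf_p1 Rf_p2 Rf_id Rf_comp[OF Ex.prems(2)])
  then have "Ar (\<lambda>z. sat M (\<lambda>k. h k z) E p)" using Ex by simp
  moreover have "(\<lambda>k. h k z) = (\<lambda>k. g k (p1 z))(x := p2 z)" for z
    by (auto simp: h_def)
  ultimately show ?case by (simp add: Ar_ex[OF assms(1)])
qed (auto intro!: Ar_intros Rf_tm_val)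

lemma ACA0_if_projection_closed:
  assumes projection_closed
  shows "ACA0 M"
  unfolding ACA0_def arithmetical_comprehension_def
proof (intro conjI RCA0 allI impI)
  fix p x and e :: "nat \<Rightarrow> 'a" and E :: "nat \<Rightarrow> 'a set"
  assume p: "arithmetical p" "range E \<subseteq> setsM M"
  define g where "g k = (\<lambda>c. if k = x then c else e k)" for k
  have "Rf (g k)" for k unfolding g_def by (intro Rf_if Ar_const Rf_id Rf_const)
  then have "Ar (\<lambda>c. sat M (\<lambda>k. g k c) E p)" by (intro Ar_sat assms p)
  moreover have "(\<lambda>k. g k c) = e(x := c)" for c by (auto simp: g_def)
  ultimately show "{a. sat M (e(x := a)) E p} \<in> setsM M" by (simp add: Ar_def)
qed

section \<open>From Euler paths to arithmetical comprehension\<close>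

text \<open>
  Put the edge \<open>{u, u + 1}\<close> into the graph \<open>G\<^sub>i\<close> iff \<open>P (i, j)\<close> holds for some \<open>j \<le> u\<close>.
  If \<open>P (i, j)\<close> holds for some \<open>j\<close> then \<open>G\<^sub>i\<close> is a ray, otherwise it has no edges.
\<close>

definition ray_edge :: "('a \<Rightarrow> bool) \<Rightarrow> 'a \<Rightarrow> 'a \<Rightarrow> 'a \<Rightarrow> bool" where
  "ray_edge P i u v \<longleftrightarrow>
     v = u \<oplus> \<one> \<and> (\<exists>j. j \<prec> v \<and> P (pair i j)) \<or> u = v \<oplus> \<one> \<and> (\<exists>j. j \<prec> u \<and> P (pair i j))"

text \<open>The least \<open>j\<close> with \<open>P (pair i j)\<close> is the start of the ray, and
  walking upwards from it uses each edge once.\<close>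

lemma ray_edge_has_euler_path:
  assumes P: "Ar P" "P (pair i j)"
  shows "has_euler_path M UNIV {(u, v). ray_edge P i u v}"
proof -
  have "Ar (\<lambda>j. P (pair i j))" by (intro Ar_comp[OF P(1)] Ar_intros)
  from least_M[OF this P(2)] obtain m
    where m: "P (pair i m)" "\<And>j. j \<prec> m \<Longrightarrow> \<not> P (pair i j)" by blast
  have edge: "ray_edge P i u v \<longleftrightarrow> m \<preceq> u \<and> v = u \<oplus> \<one> \<or> m \<preceq> v \<and> u = v \<oplus> \<one>" for u v
  proof -
    have "(\<exists>j. j \<prec> w \<oplus> \<one> \<and> P (pair i j)) \<longleftrightarrow> m \<preceq> w" for w
      using m by (metis less_succ N.le_less_trans N.not_le)
    then show ?thesis unfolding ray_edge_def by metis
  qed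
  have f: "Rf (\<lambda>n. m \<oplus> n)" by (intro Ar_intros)
  have uniq: "\<exists>!n. {m \<oplus> n, m \<oplus> (n \<oplus> \<one>)} = {w, w \<oplus> \<one>}" if "m \<preceq> w" for w
  proof (rule ex_ex1I)
    obtain k where "w = m \<oplus> k" using \<open>m \<preceq> w\<close> leq_iff by blast
    then show "\<exists>n. {m \<oplus> n, m \<oplus> (n \<oplus> \<one>)} = {w, w \<oplus> \<one>}"
      by (intro exI[of _ k]) (simp add: basic_rec(1))
  next
    \<comment> \<open>Passing the edge downwards would give
      \<open>w \<oplus> \<one> \<oplus> \<one> = w\<close>.\<close>
    have "m \<oplus> n = w" if "{m \<oplus> n, m \<oplus> (n \<oplus> \<one>)} = {w, w \<oplus> \<one>}" for n
    proof (rule ccontr)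
      assume "m \<oplus> n \<noteq> w"
      then have "m \<oplus> n = w \<oplus> \<one>" "m \<oplus> n \<oplus> \<one> = w"
        using that by (auto simp: doubleton_eq_iff basic_rec(1))
      then show False by (metis N.less_add_one N.less_asym)
    qed
    then show "n = n'" if "{m \<oplus> n, m \<oplus> (n \<oplus> \<one>)} = {w, w \<oplus> \<one>}" "{m \<oplus> n', m \<oplus> (n' \<oplus> \<one>)} = {w, w \<oplus> \<one>}" for n n'
      using that by (metis N.add_left_cancel)
  qed
  have "is_euler_path M UNIV {(u, v). ray_edge P i u v} (\<lambda>n. m \<oplus> n)"
    unfolding is_euler_path_def is_path_def
  proof (intro conjI allI f)
    show "\<forall>(u, v)\<in>{(u, v). ray_edge P i u v}. \<exists>!n. {m \<oplus> n, m \<oplus> (n \<oplus> \<one>)} = {u, v}"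
      using uniq by (auto simp: edge insert_commute)
  qed (auto simp: edge basic_rec(1))
  then show ?thesis by (auto simp: has_euler_path_def)
qed

lemma projection_closed_if_euler_path_sets_exist:
  assumes "euler_path_sets_exist M"
  shows projection_closed
  unfolding projection_closed_def
proof (intro allI impI)
  fix P assume P: "Ar P"
  define EE where "EE = {z. ray_edge P (p1 z) (p1 (p2 z)) (p2 (p2 z))}"
  have edges: "edges_at M EE i = {(u, v). ray_edge P i u v}" for i
    by (simp add: edges_at_def EE_def)
  \<comment> \<open>The bound on \<open>j\<close> in \<open>ray_edge\<close> matters here: it keeps
    the edge set recursive in \<open>P\<close>, which an unbounded search for \<open>j\<close> would
    not.\<close>
  have "Ar (\<lambda>z. ray_edge P (p1 z) (p1 (p2 z)) (p2 (p2 z)))"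
    unfolding ray_edge_def by (intro Ar_intros Ar_comp[OF P])
  then have EE: "EE \<in> setsM M" by (simp add: Ar_def EE_def)
  have UN: "UNIV \<in> setsM M" using Ar_const[of True] by (simp add: Ar_def)
  have vertices: "vertices_at M UNIV i = UNIV" for i by (simp add: vertices_at_def)
  have "graph_sequence M UNIV EE"
    unfolding graph_sequence_def is_graph_def vertices edges
    using EE UN by (auto simp: ray_edge_def sym_def irrefl_def)
  then obtain Z where Z: "Z \<in> setsM M"
    "\<And>i. i \<in> Z \<longleftrightarrow> has_euler_path M UNIV {(u, v). ray_edge P i u v}"
    using assms unfolding euler_path_sets_exist_def vertices edges[symmetric] by (metis vertices)
  have "i \<in> Z \<longleftrightarrow> (\<exists>j. P (pair i j))" for i
  proof
    assume "i \<in> Z"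
    then obtain f where "is_path M UNIV {(u, v). ray_edge P i u v} f"
      by (auto simp: Z(2) has_euler_path_def is_euler_path_def)
    \<comment> \<open>Paths are infinite, so there is an edge at index zero, and an edge comes with
      a witness \<open>j\<close>.\<close>
    then have "ray_edge P i (f \<zero>) (f (\<zero> \<oplus> \<one>))" unfolding is_path_def by blast
    then show "\<exists>j. P (pair i j)" by (auto simp: ray_edge_def)
  qed (auto simp: Z(2) intro: ray_edge_has_euler_path P)
  then have "Z = {i. \<exists>j. P (pair i j)}" by blast
  with Z(1) show "Ar (\<lambda>c. \<exists>a. P (pair c a))" by (simp add: Ar_def)
qed

end

section \<open>Coding of finite sets and sequences\<close>

locale aca = rca +
  assumes projection_closed: projection_closed
begin

lemmas Ar_ex = Ar_ex[OF projection_closed]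
lemmas Ar_all = Ar_all[OF projection_closed]
lemmas Ar_intros = Ar_intros Ar_ex Ar_all

text \<open>The bound for \<open>k \<oplus> \<one>\<close> is the old one plus the successor of one
  new witness. The induction formula has an unbounded quantifier over \<open>m\<close>; closure
  under projection makes it definable.\<close>

lemma collection:
  assumes P: "Ar (\<lambda>z. P (p1 z) (p2 z))" and ex: "\<And>x. x \<prec> n \<Longrightarrow> \<exists>y. P x y"
  shows "\<exists>m. \<forall>x. x \<prec> n \<longrightarrow> (\<exists>y. y \<prec> m \<and> P x y)"
proof -
  have "k \<preceq> n \<longrightarrow> (\<exists>m. \<forall>x. x \<prec> k \<longrightarrow> (\<exists>y. y \<prec> m \<and> P x y))" for k
  proof (induction k rule: induct_M)
    case (succ k)
    show ?case
    proof
      assume k: "k \<oplus> \<one> \<preceq> n"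
      then have "k \<prec> n" by (simp add: less_leq_succ)
      with succ obtain m where m: "\<And>x. x \<prec> k \<Longrightarrow> \<exists>y. y \<prec> m \<and> P x y"
        by (auto simp: leq_def)
      obtain y where y: "P k y" using ex \<open>k \<prec> n\<close> by blast
      have "\<exists>y'. y' \<prec> m \<oplus> (y \<oplus> \<one>) \<and> P x y'" if "x \<prec> k \<oplus> \<one>" for x
      proof (cases "x = k")
        case True
        have "y \<prec> m \<oplus> (y \<oplus> \<one>)" by (metis N.add.left_commute less_plus)
        then show ?thesis using True y by blast
      next
        case False
        then have "x \<prec> k" using that basic_rec(3) by blast
        then show ?thesis using m less_plus N.less_trans by blast
      qed
      then show "\<exists>m. \<forall>x. x \<prec> k \<oplus> \<one> \<longrightarrow> (\<exists>y. y \<prec> m \<and> P x y)" by blast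
    qed
  next
    case definable
    show ?case by (intro Ar_intros Ar_binary[OF P])
  qed auto
  then show ?thesis by blast
qed

section \<open>Divisibility and codes of finite sets\<close>

definition divides (infix "divides" 50) where "a divides b \<longleftrightarrow> (\<exists>k. b = a \<otimes> k)"

lemma divides_mult: "a divides b \<Longrightarrow> a divides b \<otimes> c"
  unfolding divides_def using N.mult.assoc by blast

lemma divides_add: "a divides b \<Longrightarrow> a divides b \<oplus> c \<longleftrightarrow> a divides c"
proof
  assume "a divides b" "a divides b \<oplus> c"
  then obtain k l where k: "b = a \<otimes> k" and l: "b \<oplus> c = a \<otimes> l" by (auto simp: divides_def)
  have "c = (b \<oplus> c) \<ominus> b" by simp
  also have "\<dots> = a \<otimes> (l \<ominus> k)" by (simp add: k l[unfolded k] times_minus)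
  finally show "a divides c" by (auto simp: divides_def)
qed (auto simp: divides_def times_distrib[symmetric])

text \<open>This stands in for a factorial: the old multiple is multiplied by
  \<open>n \<oplus> \<one>\<close>.\<close>

lemma common_multiple: "\<exists>d. \<zero> \<prec> d \<and> (\<forall>x. \<zero> \<prec> x \<and> x \<preceq> n \<longrightarrow> x divides d)"
proof (induction n rule: induct_M)
  case zero
  show ?case by (rule exI[of _ \<one>]) (auto simp: leq_def N.zero_less_one)
next
  case (succ n)
  then obtain d where d: "\<zero> \<prec> d" "\<And>x. \<zero> \<prec> x \<Longrightarrow> x \<preceq> n \<Longrightarrow> x divides d" by blast
  have "\<zero> \<prec> d \<otimes> (n \<oplus> \<one>)" using d(1) by (intro times_pos) (auto simp: less_succ)
  moreover have "x divides d \<otimes> (n \<oplus> \<one>)" if "\<zero> \<prec> x" "x \<preceq> n \<oplus> \<one>" for x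
  proof (cases "x = n \<oplus> \<one>")
    case True
    then show ?thesis unfolding divides_def using N.mult.commute by blast
  next
    case False
    then have "x \<preceq> n" using that(2) by (simp add: leq_def basic_rec(3))
    then show ?thesis using d(2) that(1) divides_mult by blast
  qed
  ultimately show ?case by blast
qed (unfold divides_def, intro Ar_intros)

text \<open>These are the moduli of Goedel's beta function.\<close>

definition modulus where "modulus d x = \<one> \<oplus> (x \<oplus> \<one>) \<otimes> d"

text \<open>The two moduli differ by \<open>e \<otimes> d\<close>, where the distance
  \<open>e\<close> of \<open>x\<close> and \<open>k\<close> divides \<open>d\<close>. So the modulus
  at \<open>x\<close> divides \<open>a \<otimes> d \<otimes> d\<close> up to a factor; being one
  more than a multiple of \<open>d\<close>, it lets both factors \<open>d\<close> be cancelled.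
  Explicit identities replace gcds and primes.\<close>

lemma modulus_coprime:
  assumes n: "\<And>e. \<zero> \<prec> e \<Longrightarrow> e \<prec> n \<Longrightarrow> e divides d" and xk: "x \<prec> n" "k \<prec> n" "x \<noteq> k"
    and dv: "modulus d x divides a \<otimes> modulus d k"
  shows "modulus d x divides a"
proof -
  let ?q = "modulus d x"
  have "\<exists>e. \<zero> \<prec> e \<and> e \<prec> n \<and> ?q divides a \<otimes> (e \<otimes> d)"
  proof (cases "x \<prec> k")
    case True
    then obtain e where e: "k = x \<oplus> e" "\<zero> \<prec> e"
      by (metis less_iff N.add_pos_nonneg N.zero_less_one N.add.commute zero_leq)
    have "e \<preceq> k" by (simp add: e)
    then have "e \<prec> n" using xk(2) by order
    have "modulus d k = ?q \<oplus> e \<otimes> d"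
      by (simp add: e modulus_def N.distrib_right N.add.assoc N.add.left_commute N.add.commute)
    then have "a \<otimes> modulus d k = ?q \<otimes> a \<oplus> a \<otimes> (e \<otimes> d)"
      by (simp add: times_distrib N.mult.commute)
    then show ?thesis using dv e \<open>e \<prec> n\<close> divides_add divides_def by metis
  next
    case False
    then have "k \<prec> x" using xk(3) by order
    then obtain e where e: "x = k \<oplus> e" "\<zero> \<prec> e"
      by (metis less_iff N.add_pos_nonneg N.zero_less_one N.add.commute zero_leq)
    have "e \<preceq> x" by (simp add: e)
    then have "e \<prec> n" using xk(1) by order
    have "?q = modulus d k \<oplus> e \<otimes> d"
      by (simp add: e modulus_def N.distrib_right N.add.assoc N.add.left_commute N.add.commute)
    then have "?q \<otimes> a = a \<otimes> modulus d k \<oplus> a \<otimes> (e \<otimes> d)"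
      by (simp add: times_distrib N.mult.commute)
    then show ?thesis using dv e \<open>e \<prec> n\<close> divides_add divides_def by metis
  qed
  then obtain e where e: "e divides d" "?q divides a \<otimes> (e \<otimes> d)" using n by blast
  then obtain f where f: "d = e \<otimes> f" by (auto simp: divides_def)
  have "a \<otimes> (e \<otimes> d) \<otimes> f = a \<otimes> d \<otimes> d"
    unfolding f by (simp add: N.mult.assoc N.mult.left_commute N.mult.commute)
  then have 1: "?q divides (a \<otimes> d \<otimes> d) \<otimes> (x \<oplus> \<one>)" using e(2) divides_mult by metis
  \<comment> \<open>A multiple of \<open>?q\<close> equals another multiple of \<open>?q\<close>
    plus \<open>a \<otimes> d\<close>, which is therefore divisible too. The same identity, with
    \<open>a\<close> for \<open>a \<otimes> d\<close>, removes the other factor.\<close>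
  have "?q \<otimes> (a \<otimes> d) = (a \<otimes> d \<otimes> d) \<otimes> (x \<oplus> \<one>) \<oplus> a \<otimes> d"
    by (simp add: modulus_def N.distrib_right N.distrib_left N.mult.assoc N.mult.left_commute N.mult.commute
         N.add.assoc N.add.left_commute N.add.commute)
  then have "?q divides a \<otimes> d" using divides_add[OF 1] divides_def by metis
  then have 2: "?q divides (a \<otimes> d) \<otimes> (x \<oplus> \<one>)" by (rule divides_mult)
  have "?q \<otimes> a = (a \<otimes> d) \<otimes> (x \<oplus> \<one>) \<oplus> a"
    by (simp add: modulus_def N.distrib_right N.distrib_left N.mult.assoc N.mult.left_commute N.mult.commute
         N.add.assoc N.add.left_commute N.add.commute)
  then show ?thesis using divides_add[OF 2] divides_def by metis
qed

lemma modulus_not_divides_one: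
  assumes "\<zero> \<prec> d"
  shows "\<not> modulus d x divides \<one>"
proof
  assume "modulus d x divides \<one>"
  then obtain k where k: "\<one> = modulus d x \<otimes> k" by (auto simp: divides_def)
  then obtain l where "k = l \<oplus> \<one>" using nonzero_succ one_nonzero basic(4) by metis
  then have "\<one> = modulus d x \<otimes> l \<oplus> modulus d x" using k basic_rec(2) by metis
  then have "modulus d x \<preceq> \<one>" by (metis N.le_add_same_cancel2 zero_leq)
  moreover have "\<zero> \<prec> (x \<oplus> \<one>) \<otimes> d" using assms by (intro times_pos) (auto simp: less_succ)
  ultimately show False unfolding modulus_def
    by (metis N.less_add_same_cancel1 N.not_le)
qed

text \<open>The set with code \<open>(a, (d, n))\<close> consists of those \<open>x < n\<close> for which \<open>1 + (x + 1) d\<close>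
  divides \<open>a\<close>.\<close>

definition el where
  "el x c \<longleftrightarrow> x \<prec> p2 (p2 c) \<and> modulus (p1 (p2 c)) x divides p1 c"

lemma Ar_el: "Rf f \<Longrightarrow> Rf g \<Longrightarrow> Ar (\<lambda>c. el (f c) (g c))"
  by (rule Ar_binary[of el]) (unfold el_def divides_def modulus_def, intro Ar_intros)

lemma p2_leq: "p2 c \<preceq> c"
  by (cases "\<exists>m n. c = pair m n") (auto simp: p2_def)

lemma el_less: "el x c \<Longrightarrow> x \<prec> c"
  unfolding el_def using p2_leq N.less_le_trans by blast

text \<open>The witness is the product of the moduli at the members of \<open>S\<close> below
  \<open>n\<close>, built one factor at a time; by \<open>modulus_coprime\<close> a new factor
  affects no other modulus.\<close>

lemma code_exists:
  assumes S: "Ar S"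
  shows "\<exists>c. \<forall>x. el x c \<longleftrightarrow> x \<prec> n \<and> S x"
proof -
  obtain d where d: "\<zero> \<prec> d" "\<And>x. \<zero> \<prec> x \<Longrightarrow> x \<prec> n \<Longrightarrow> x divides d"
    using common_multiple[of n] leq_def by metis
  have "\<exists>a. \<forall>x. x \<prec> n \<longrightarrow> (modulus d x divides a \<longleftrightarrow> x \<prec> k \<and> S x)" for k
  proof (induction k rule: induct_M)
    case zero
    show ?case by (rule exI[of _ \<one>]) (auto simp: modulus_not_divides_one[OF d(1)])
  next
    case (succ k)
    then obtain a where a: "\<And>x. x \<prec> n \<Longrightarrow> modulus d x divides a \<longleftrightarrow> x \<prec> k \<and> S x" by blast
    show ?case
    proof (cases "k \<prec> n \<and> S k")
      case True
      have "modulus d x divides a \<otimes> modulus d k \<longleftrightarrow> x \<prec> k \<oplus> \<one> \<and> S x" if "x \<prec> n" for x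
      proof (cases "x = k")
        case True
        then show ?thesis using \<open>k \<prec> n \<and> S k\<close> N.mult.commute
          by (auto simp: divides_def basic_rec(3))
      next
        case False
        then have "modulus d x divides a \<otimes> modulus d k \<longleftrightarrow> modulus d x divides a"
          using modulus_coprime[OF d(2)] that \<open>k \<prec> n \<and> S k\<close> divides_mult by blast
        then show ?thesis using a that False by (simp add: basic_rec(3))
      qed
      then show ?thesis by blast
    next
      case False
      then have "modulus d x divides a \<longleftrightarrow> x \<prec> k \<oplus> \<one> \<and> S x" if "x \<prec> n" for x
        using a that by (auto simp: basic_rec(3))
      then show ?thesis by blast
    qed
  qed (unfold modulus_def divides_def, intro Ar_intros Ar_comp[OF S])
  from this[of n] obtain a where "\<And>x. x \<prec> n \<Longrightarrow> modulus d x divides a \<longleftrightarrow> S x" by blast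
  then show ?thesis by (intro exI[of _ "pair a (pair d n)"]) (auto simp: el_def)
qed

section \<open>Least search, coded sequences and recursion\<close>

definition least where
  "least P = (if \<exists>a. P a then THE a. P a \<and> (\<forall>b. b \<prec> a \<longrightarrow> \<not> P b) else \<zero>)"

lemma least_eq: "P a \<Longrightarrow> (\<And>b. b \<prec> a \<Longrightarrow> \<not> P b) \<Longrightarrow> least P = a"
  unfolding least_def by (auto intro!: the_equality) (meson N.neqE)

lemma least_holds: "Ar P \<Longrightarrow> P a \<Longrightarrow> P (least P)"
  using least_M[of P a] least_eq[of P] by metis

text \<open>Whether the search succeeds is expressed by a number quantifier, so closure under
  projection yields a total function with default zero.\<close>

lemma Rf_least:
  assumes P: "Ar (\<lambda>z. P (p1 z) (p2 z))"
  shows "Rf (\<lambda>c. least (P c))"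
proof (rule RfI)
  have PA: "Ar (P c)" for c using Ar_binary[OF P Rf_const Rf_id] .
  have "y = least (P c) \<longleftrightarrow> (P c y \<and> (\<forall>b. b \<prec> y \<longrightarrow> \<not> P c b)) \<or> ((\<forall>a. \<not> P c a) \<and> y = \<zero>)" for y c
  proof (cases "\<exists>a. P c a")
    case True
    then show ?thesis using least_M[OF PA] least_eq[of "P c"] by metis
  qed (simp add: least_def)
  moreover have "Ar (\<lambda>z. (P (p1 z) (p2 z) \<and> (\<forall>b. b \<prec> p2 z \<longrightarrow> \<not> P (p1 z) b)) \<or> ((\<forall>a. \<not> P (p1 z) a) \<and> p2 z = \<zero>))"
    by (intro Ar_intros Ar_binary[OF P])
  ultimately show "Ar (\<lambda>z. p2 z = least (P (p1 z)))" by simp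
qed

text \<open>A sequence is a finite set of pairs. Every element codes a total sequence, with zero
  where no entry is stored, so lengths are carried separately.\<close>

definition seq where "seq c i = least (\<lambda>y. el (pair i y) c)"

lemma Rf_seq: "Rf f \<Longrightarrow> Rf g \<Longrightarrow> Rf (\<lambda>c. seq (f c) (g c))"
  by (rule Rf_binary_comp[of seq]) (unfold seq_def, intro Rf_least Ar_el Ar_intros)

text \<open>This lets a bound on codes of trails and walks serve as a bound on all their
  vertices.\<close>

lemma seq_leq: "seq c i \<preceq> c"
proof (cases "\<exists>y. el (pair i y) c")
  case True
  have "Ar (\<lambda>y. el (pair i y) c)" by (intro Ar_el Ar_intros)
  from least_holds[OF this] True have "el (pair i (seq c i)) c" by (auto simp: seq_def)
  then have "pair i (seq c i) \<prec> c" by (rule el_less)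
  then show ?thesis by (meson leq_pair(2) N.le_less_trans N.less_imp_le)
qed (simp add: seq_def least_def)

lemma seq_exists:
  assumes f: "Rf f"
  shows "\<exists>c. \<forall>i. i \<prec> n \<longrightarrow> seq c i = f i"
proof -
  have "Ar (\<lambda>z. p2 z = pair (p1 z) (f (p1 z)))"
    by (intro Ar_intros Rf_comp[OF f])
  from collection[of "\<lambda>x y. y = pair x (f x)", OF this, of n]
  obtain B where B: "\<And>i. i \<prec> n \<Longrightarrow> pair i (f i) \<prec> B" by blast
  have "Ar (\<lambda>z. \<exists>i. i \<prec> n \<and> z = pair i (f i))" by (intro Ar_intros Rf_comp[OF f])
  then obtain c where c: "\<And>x. el x c \<longleftrightarrow> x \<prec> B \<and> (\<exists>i. i \<prec> n \<and> x = pair i (f i))"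
    using code_exists by blast
  have "el (pair i y) c \<longleftrightarrow> y = f i" if "i \<prec> n" for i y using c B that by auto
  then have "seq c i = f i" if "i \<prec> n" for i unfolding seq_def
    using that by (intro least_eq) auto
  then show ?thesis by blast
qed

text \<open>\<open>F s\<close> is the entry at \<open>s\<close> of the least code of a computation
  of length \<open>s\<close>. Computations exist by induction and agree wherever both are defined,
  so the choice of the code does not matter.\<close>

lemma recursion:
  assumes h: "Rf h"
  shows "\<exists>F. Rf F \<and> F \<zero> = a \<and> (\<forall>s. F (s \<oplus> \<one>) = h (pair s (F s)))"
proof -
  define cmp where "cmp d s \<longleftrightarrow> seq d \<zero> = a \<and> (\<forall>i. i \<prec> s \<longrightarrow> seq d (i \<oplus> \<one>) = h (pair i (seq d i)))" for d s
  have Ar_cmp: "Rf f \<Longrightarrow> Rf g \<Longrightarrow> Ar (\<lambda>c. cmp (f c) (g c))" for f g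
    by (rule Ar_binary[of cmp]) (unfold cmp_def, intro Ar_intros Rf_seq Rf_comp[OF h])
  have ex: "\<exists>d. cmp d s" for s
  proof (induction s rule: induct_M)
    case zero
    obtain d where "\<And>i. i \<prec> \<one> \<Longrightarrow> seq d i = a" using seq_exists[OF Rf_const, of \<one> a] by blast
    then show ?case unfolding cmp_def using N.zero_less_one by (intro exI[of _ d]) auto
  next
    case (succ s)
    then obtain d where d: "cmp d s" by blast
    \<comment> \<open>Only the entry at \<open>s \<oplus> \<one>\<close> counts as new:
      \<open>cmp\<close> looks no further, whatever the last clause puts beyond.\<close>
    define f where "f i = (if i \<preceq> s then seq d i else h (pair s (seq d s)))" for i
    have "Rf f" unfolding f_def by (intro Ar_intros Rf_seq)
    then obtain d' where d': "\<And>i. i \<prec> s \<oplus> \<one> \<oplus> \<one> \<Longrightarrow> seq d' i = f i" using seq_exists by blast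
    have "cmp d' (s \<oplus> \<one>)" unfolding cmp_def
    proof (intro conjI allI impI)
      show "seq d' \<zero> = a" using d d'[of \<zero>] by (simp add: f_def cmp_def less_succ)
    next
      fix i assume i: "i \<prec> s \<oplus> \<one>"
      then have i': "i \<preceq> s" by (simp add: less_succ)
      have e: "seq d' i = seq d i" "seq d' (i \<oplus> \<one>) = f (i \<oplus> \<one>)"
        using d'[of i] d'[of "i \<oplus> \<one>"] i i' by (auto simp: f_def basic_rec(3)[of i])
      show "seq d' (i \<oplus> \<one>) = h (pair i (seq d' i))"
      proof (cases "i = s")
        case True
        then show ?thesis using e by (simp add: f_def)
      next
        case False
        then have "i \<prec> s" using i' by order
        then show ?thesis using e d by (simp add: f_def cmp_def less_leq_succ[symmetric])
      qed
    qed
    then show ?case by blast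
  next
    case definable
    show ?case by (intro Ar_intros Ar_cmp)
  qed
  have uniq: "j \<preceq> s \<Longrightarrow> j \<preceq> s' \<Longrightarrow> seq d j = seq d' j" if "cmp d s" "cmp d' s'" for d d' s s' j
  proof -
    have "j \<preceq> s \<and> j \<preceq> s' \<longrightarrow> seq d j = seq d' j"
    proof (induction j rule: induct_M)
      case (succ j)
      then show ?case using that unfolding cmp_def
        by (metis less_leq_succ N.less_imp_le)
    next
      case definable
      show ?case by (intro Ar_intros Rf_seq)
    qed (use that in \<open>auto simp: cmp_def\<close>)
    then show "j \<preceq> s \<Longrightarrow> j \<preceq> s' \<Longrightarrow> seq d j = seq d' j" by blast
  qed
  define F where "F s = seq (least (\<lambda>d. cmp d s)) s" for s
  have "Rf F" unfolding F_def by (intro Rf_seq Rf_least Ar_cmp Ar_intros)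
  moreover have c: "cmp (least (\<lambda>d. cmp d s)) s" for s
    using ex[of s] least_holds[of "\<lambda>d. cmp d s"] Ar_cmp[OF Rf_id Rf_const] by blast
  have "F \<zero> = a" using c[of \<zero>] by (simp add: F_def cmp_def)
  moreover have "F (s \<oplus> \<one>) = h (pair s (F s))" for s
  proof -
    have "F s = seq (least (\<lambda>d. cmp d (s \<oplus> \<one>))) s"
      unfolding F_def using uniq[OF c c, of s s "s \<oplus> \<one>"] by (simp add: leq_def basic_rec)
    then show ?thesis using c[of "s \<oplus> \<one>"] by (simp add: F_def cmp_def less_succ)
  qed
  ultimately show ?thesis by blast
qed

section \<open>Trails\<close>

definition same_edge :: "'a \<Rightarrow> 'a \<Rightarrow> 'a \<Rightarrow> 'a \<Rightarrow> bool" where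
  "same_edge u v x y \<longleftrightarrow> u = x \<and> v = y \<or> u = y \<and> v = x"

definition traverses :: "('a \<Rightarrow> 'a) \<Rightarrow> 'a \<Rightarrow> 'a \<Rightarrow> 'a \<Rightarrow> bool" where
  "traverses f i u v \<longleftrightarrow> same_edge (f i) (f (i \<oplus> \<one>)) u v"

definition uses :: "('a \<Rightarrow> 'a) \<Rightarrow> 'a \<Rightarrow> 'a \<Rightarrow> 'a \<Rightarrow> bool" where
  "uses f n u v \<longleftrightarrow> (\<exists>i. i \<prec> n \<and> traverses f i u v)"

text \<open>The length \<open>n\<close> counts edges; the vertices are at the positions up to and
  including \<open>n\<close>.\<close>

definition trail :: "('a \<Rightarrow> 'a \<Rightarrow> bool) \<Rightarrow> ('a \<Rightarrow> 'a) \<Rightarrow> 'a \<Rightarrow> bool" where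
  "trail R f n \<longleftrightarrow> (\<forall>i. i \<prec> n \<longrightarrow> R (f i) (f (i \<oplus> \<one>))) \<and>
     (\<forall>i. i \<prec> n \<longrightarrow> (\<forall>j. j \<prec> n \<longrightarrow> traverses f i (f j) (f (j \<oplus> \<one>)) \<longrightarrow> i = j))"

lemma trail_edge: "trail R f n \<Longrightarrow> i \<prec> n \<Longrightarrow> R (f i) (f (i \<oplus> \<one>))"
  by (simp add: trail_def)

lemma traverses_sym: "traverses f i u v \<longleftrightarrow> traverses f i v u"
  by (auto simp: traverses_def same_edge_def)

lemma uses_step: "i \<prec> n \<Longrightarrow> uses f n (f i) (f (i \<oplus> \<one>))"
  by (auto simp: uses_def traverses_def same_edge_def)

lemma trail_unique:
  "trail R f n \<Longrightarrow> i \<prec> n \<Longrightarrow> j \<prec> n \<Longrightarrow> traverses f i u v \<Longrightarrow> traverses f j u v \<Longrightarrow> i = j"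
  unfolding trail_def traverses_def same_edge_def by metis

lemma trail_uses_R: "trail R f n \<Longrightarrow> symp R \<Longrightarrow> uses f n u v \<Longrightarrow> R u v"
  by (auto simp: trail_def uses_def traverses_def same_edge_def symp_def)

section \<open>Reversal of closed segments\<close>

definition flip :: "('a \<Rightarrow> 'a) \<Rightarrow> 'a \<Rightarrow> 'a \<Rightarrow> 'a \<Rightarrow> 'a" where
  "flip g s t i = (if s \<preceq> i \<and> i \<preceq> t then g ((s \<oplus> t) \<ominus> i) else g i)"

lemma add_minus_eq: "i \<oplus> j = m \<Longrightarrow> m \<ominus> i = j"
  by auto

lemma flip_eq:
  assumes "s \<preceq> i" "i \<preceq> t" "i \<oplus> j = s \<oplus> t"
  shows "flip g s t i = g j"
  using assms add_minus_eq[OF assms(3)] by (simp add: flip_def)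

text \<open>Subtraction is not among the functions of \<open>Ar_intros\<close>, so the mirrored
  position is found by a least search for the solution of an equation.\<close>

lemma Rf_flip: "Rf g \<Longrightarrow> Rf (flip g s t)"
proof -
  assume g: "Rf g"
  have m: "(s \<oplus> t) \<ominus> i = least (\<lambda>j. i \<oplus> j = s \<oplus> t)" if "i \<preceq> t" for i
  proof -
    obtain b where "t = i \<oplus> b" using \<open>i \<preceq> t\<close> leq_iff by blast
    then have "i \<oplus> (s \<oplus> b) = s \<oplus> t" by (simp add: N.add.left_commute)
    then obtain j where j: "i \<oplus> j = s \<oplus> t" by blast
    then have "least (\<lambda>j. i \<oplus> j = s \<oplus> t) = j"
      by (intro least_eq) (auto simp: j[symmetric])
    then show ?thesis using add_minus_eq[OF j] by simp
  qed
  have "flip g s t = (\<lambda>i. if s \<preceq> i \<and> i \<preceq> t then g (least (\<lambda>j. i \<oplus> j = s \<oplus> t)) else g i)"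
    by (auto simp: flip_def m fun_eq_iff)
  moreover have "Rf (\<lambda>i. if s \<preceq> i \<and> i \<preceq> t then g (least (\<lambda>j. i \<oplus> j = s \<oplus> t)) else g i)"
    by (intro Ar_intros Rf_comp[OF g] Rf_least)
  ultimately show ?thesis by simp
qed

text \<open>Both ends of a closed segment carry the same vertex, so the reversal is invisible at
  \<open>s\<close> and \<open>t\<close> as well.\<close>

lemma flip_outside:
  assumes "g s = g t" "i \<preceq> s \<or> t \<preceq> i" "s \<preceq> t"
  shows "flip g s t i = g i"
proof (cases "s \<preceq> i \<and> i \<preceq> t")
  case True
  then have "i = s \<or> i = t" using assms by auto
  then show ?thesis
  proof
    assume "i = s" then show ?thesis using flip_eq[of s i t t g] assms by simp
  next
    assume "i = t" then show ?thesis using flip_eq[of s i t s g] assms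
      by (simp add: N.add.commute)
  qed
qed (auto simp: flip_def)

lemma traverses_flip_inside:
  assumes "s \<preceq> i" "i \<prec> t" "i \<oplus> (j \<oplus> \<one>) = s \<oplus> t"
  shows "flip g s t i = g (j \<oplus> \<one>)" "flip g s t (i \<oplus> \<one>) = g j"
proof -
  show "flip g s t i = g (j \<oplus> \<one>)" using assms by (intro flip_eq) auto
  have "s \<preceq> i \<oplus> \<one>" using assms(1) less_succ by (meson N.less_imp_le)
  moreover have "i \<oplus> \<one> \<preceq> t" using assms(2) by (simp add: less_leq_succ)
  moreover have "i \<oplus> \<one> \<oplus> j = s \<oplus> t" using assms(3) by (metis basic_rec(1) succ_plus)
  ultimately show "flip g s t (i \<oplus> \<one>) = g j" by (intro flip_eq) auto
qed

lemma reflect_pos: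
  assumes "s \<preceq> i" "i \<prec> t"
  shows "\<exists>j. i \<oplus> (j \<oplus> \<one>) = s \<oplus> t \<and> s \<preceq> j \<and> j \<prec> t"
proof -
  obtain a where a: "i = s \<oplus> a" using assms leq_iff by blast
  obtain b where b: "t = i \<oplus> (b \<oplus> \<one>)" using assms less_iff by blast
  have "t = (s \<oplus> b) \<oplus> (a \<oplus> \<one>)" by (simp add: a b N.add.assoc N.add.left_commute N.add.commute)
  moreover have "i \<oplus> (s \<oplus> b \<oplus> \<one>) = s \<oplus> t" by (simp add: a b N.add.assoc N.add.left_commute N.add.commute)
  ultimately show ?thesis using less_iff by (intro exI[of _ "s \<oplus> b"]) auto
qed

text \<open>\<open>pos i\<close> is the position in \<open>g\<close> of the edge that the reversed trail traverses at \<open>i\<close>.\<close>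

lemma flip_positions:
  assumes "g s = g t" "s \<preceq> t"
  shows "\<exists>pos. (\<forall>i. pos (pos i) = i) \<and> (\<forall>i m. t \<preceq> m \<longrightarrow> i \<prec> m \<longrightarrow> pos i \<prec> m) \<and>
    (\<forall>i u v. traverses (flip g s t) i u v \<longleftrightarrow> traverses g (pos i) u v)"
proof -
  \<comment> \<open>An edge is named by its earlier position, and reversal turns the earlier end
    into the later one; so its mirror image is off by one from that of a vertex.\<close>
  define pos where "pos i = (if s \<preceq> i \<and> i \<prec> t then (s \<oplus> t) \<ominus> (i \<oplus> \<one>) else i)" for i
  have eq: "pos i = j" if "s \<preceq> i" "i \<prec> t" "i \<oplus> (j \<oplus> \<one>) = s \<oplus> t" for i j
  proof -
    have "i \<oplus> \<one> \<oplus> j = s \<oplus> t" using that by (metis basic_rec(1) succ_plus)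
    then have "(s \<oplus> t) \<ominus> (i \<oplus> \<one>) = j" by (rule add_minus_eq)
    then show ?thesis using that(1,2) by (simp add: pos_def)
  qed
  have "pos (pos i) = i" for i
  proof (cases "s \<preceq> i \<and> i \<prec> t")
    case True
    then obtain j where j: "i \<oplus> (j \<oplus> \<one>) = s \<oplus> t" "s \<preceq> j" "j \<prec> t" using reflect_pos by blast
    then have "j \<oplus> (i \<oplus> \<one>) = s \<oplus> t" by (metis N.add.left_commute N.add.commute)
    then show ?thesis using eq j True by metis
  qed (auto simp: pos_def)
  moreover have "pos i \<prec> m" if "t \<preceq> m" "i \<prec> m" for i m
  proof (cases "s \<preceq> i \<and> i \<prec> t")
    case True
    then obtain j where j: "i \<oplus> (j \<oplus> \<one>) = s \<oplus> t" "s \<preceq> j" "j \<prec> t" using reflect_pos by blast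
    then show ?thesis using eq True that N.less_le_trans by metis
  qed (use that in \<open>auto simp: pos_def\<close>)
  moreover have "traverses (flip g s t) i u v \<longleftrightarrow> traverses g (pos i) u v" for i u v
  proof (cases "s \<preceq> i \<and> i \<prec> t")
    case True
    then obtain j where j: "i \<oplus> (j \<oplus> \<one>) = s \<oplus> t" "s \<preceq> j" "j \<prec> t" using reflect_pos by blast
    then show ?thesis using eq True traverses_flip_inside[of s i t j g]
      by (auto simp: traverses_def same_edge_def)
  next
    case False
    then have "i \<oplus> \<one> \<preceq> s \<or> t \<preceq> i" by (auto simp: less_leq_succ[symmetric])
    then have "i \<preceq> s \<or> t \<preceq> i" "i \<oplus> \<one> \<preceq> s \<or> t \<preceq> i \<oplus> \<one>"
      by (meson N.less_add_one N.less_imp_le N.order_trans)+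
    then have "flip g s t i = g i" "flip g s t (i \<oplus> \<one>) = g (i \<oplus> \<one>)"
      using flip_outside assms by metis+
    then show ?thesis using False by (auto simp: traverses_def pos_def)
  qed
  ultimately show ?thesis by blast
qed

lemma uses_flip:
  assumes "g s = g t" "s \<preceq> t" "t \<preceq> m"
  shows "uses (flip g s t) m u v \<longleftrightarrow> uses g m u v"
  unfolding uses_def using flip_positions[OF assms(1,2)] assms(3) by metis

lemma trail_flip:
  assumes "g s = g t" "s \<preceq> t" "t \<preceq> m" "trail R g m" "symp R"
  shows "trail R (flip g s t) m"
proof -
  obtain pos where pos: "\<And>i. pos (pos i) = i" "\<And>i. i \<prec> m \<Longrightarrow> pos i \<prec> m"
    "\<And>i u v. traverses (flip g s t) i u v \<longleftrightarrow> traverses g (pos i) u v"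
    using flip_positions[OF assms(1,2)] assms(3) by metis
  show ?thesis unfolding trail_def
  proof (intro conjI allI impI)
    fix i assume i: "i \<prec> m"
    have "uses (flip g s t) m (flip g s t i) (flip g s t (i \<oplus> \<one>))" using i by (rule uses_step)
    then show "R (flip g s t i) (flip g s t (i \<oplus> \<one>))"
      using uses_flip assms(1-3) trail_uses_R[OF assms(4,5)] by metis
  next
    fix i j assume ij: "i \<prec> m" "j \<prec> m"
      and tr: "traverses (flip g s t) i (flip g s t j) (flip g s t (j \<oplus> \<one>))"
    have "traverses (flip g s t) j (flip g s t j) (flip g s t (j \<oplus> \<one>))"
      by (simp add: traverses_def same_edge_def)
    with tr have "pos i = pos j"
      using trail_unique[OF assms(4) pos(2)[OF ij(1)] pos(2)[OF ij(2)]] unfolding pos(3) by blast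
    then show "i = j" using pos(1) by metis
  qed
qed

text \<open>The trail comes back to \<open>g k\<close> along the wanted edge, so the segment from
  \<open>k\<close> to \<open>p \<oplus> \<one>\<close> is closed; reversed, it starts with that
  edge.\<close>

lemma trail_advance_opposite:
  assumes g: "Rf g" "trail R g m" "symp R"
    and p: "k \<preceq> p" "p \<prec> m" "g p = y" "g (p \<oplus> \<one>) = g k"
  shows "\<exists>g'. Rf g' \<and> trail R g' m \<and> g' m = g m \<and> (\<forall>u v. uses g' m u v \<longleftrightarrow> uses g m u v) \<and>
    (\<forall>i. i \<preceq> k \<longrightarrow> g' i = g i) \<and> g' (k \<oplus> \<one>) = y"
proof (intro exI conjI allI impI)
  let ?t = "p \<oplus> \<one>"
  have t: "k \<prec> ?t" "?t \<preceq> m" "g k = g ?t"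
    using p by (auto simp: less_succ less_leq_succ[symmetric])
  then have "k \<preceq> ?t" by order
  note t = t this
  show "Rf (flip g k ?t)" using g by (intro Rf_flip)
  show "trail R (flip g k ?t) m" using g t by (intro trail_flip)
  show "flip g k ?t m = g m" "i \<preceq> k \<Longrightarrow> flip g k ?t i = g i" for i
    using t by (auto intro: flip_outside)
  show "uses (flip g k ?t) m u v \<longleftrightarrow> uses g m u v" for u v using t by (intro uses_flip)
  show "flip g k ?t (k \<oplus> \<one>) = y"
    using traverses_flip_inside(2)[of k k ?t p g] t p by simp
qed

text \<open>
  If the trail \<open>g\<close> traverses the edge from \<open>g k\<close> to \<open>y\<close> at some later position \<open>p\<close> and
  in that direction, then by connectivity the loop \<open>g k, \<dots>, g p\<close> meets the rest of the trail,
  and reversing the closed segment between the two visits of a common vertex changes the direction.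
\<close>

lemma trail_advance:
  assumes g: "Rf g" "trail R g m" "symp R"
    and p: "k \<preceq> p" "p \<prec> m" "traverses g p (g k) y"
    and conn: "\<And>S. Ar S \<Longrightarrow> S (g k) \<Longrightarrow> g (k \<oplus> \<one>) \<noteq> y \<Longrightarrow>
      (\<And>q u v. k \<preceq> q \<Longrightarrow> q \<prec> m \<Longrightarrow> q \<noteq> p \<Longrightarrow> traverses g q u v \<Longrightarrow> S u \<Longrightarrow> S v) \<Longrightarrow> S y"
  shows "\<exists>g'. Rf g' \<and> trail R g' m \<and> g' m = g m \<and> (\<forall>u v. uses g' m u v \<longleftrightarrow> uses g m u v) \<and>
    (\<forall>i. i \<preceq> k \<longrightarrow> g' i = g i) \<and> g' (k \<oplus> \<one>) = y"
proof -
  consider "g (k \<oplus> \<one>) = y" | "g p = y" "g (p \<oplus> \<one>) = g k"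
    | "g (k \<oplus> \<one>) \<noteq> y" "g p = g k" "g (p \<oplus> \<one>) = y"
    using p(3) by (auto simp: traverses_def same_edge_def)
  then show ?thesis
  proof cases
    case 1 then show ?thesis using g by blast
  next
    case 2 then show ?thesis using trail_advance_opposite g p by blast
  next
    case 3
    have "\<exists>a b. k \<preceq> a \<and> a \<preceq> p \<and> p \<prec> b \<and> b \<preceq> m \<and> g a = g b"
    proof (rule ccontr)
      assume no: "\<not> ?thesis"
      \<comment> \<open>\<open>S\<close> collects the loop. If no later vertex lies on it, the only
        edge at or after \<open>k\<close> that crosses its border is the one at \<open>p\<close>, so
        \<open>conn\<close> puts \<open>y\<close>, the vertex at \<open>p \<oplus> \<one>\<close>,
        into \<open>S\<close>.\<close>
      define S where "S u \<longleftrightarrow> (\<exists>a. a \<prec> p \<oplus> \<one> \<and> k \<preceq> a \<and> u = g a)" for u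
      have "Ar S" unfolding S_def by (intro Ar_intros Rf_comp[OF g(1)])
      moreover have "S (g k)" unfolding S_def using p(1) less_succ by blast
      moreover have "S v" if q: "k \<preceq> q" "q \<prec> m" "q \<noteq> p" "traverses g q u v" and "S u" for q u v
      proof -
        obtain a where a: "a \<preceq> p" "k \<preceq> a" "u = g a" using \<open>S u\<close> by (auto simp: S_def less_succ)
        show ?thesis
        proof (cases "q \<prec> p")
          case True
          then have "q \<oplus> \<one> \<preceq> p" by (simp add: less_leq_succ)
          moreover have "k \<prec> q \<oplus> \<one>" using q(1) by (simp add: less_succ)
          ultimately have "q \<prec> p \<oplus> \<one>" "q \<oplus> \<one> \<prec> p \<oplus> \<one>" "k \<preceq> q \<oplus> \<one>"
            using True by (auto simp: less_succ intro: N.less_imp_le)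
          then show ?thesis using q unfolding S_def traverses_def same_edge_def by blast
        next
          case False
          then have "p \<prec> q" using q(3) by order
          then have "p \<prec> q \<oplus> \<one>" "q \<oplus> \<one> \<preceq> m" "q \<preceq> m"
            using q(2) by (simp_all add: less_succ N.less_imp_le less_leq_succ[symmetric])
          then show ?thesis using q a no \<open>p \<prec> q\<close> unfolding traverses_def same_edge_def by metis
        qed
      qed
      ultimately have "S y" using conn 3(1) by blast
      then show False using no 3 p less_leq_succ unfolding S_def
        by (metis less_succ N.less_add_one)
    qed
    \<comment> \<open>The closed segment from \<open>a\<close> to \<open>b\<close> contains the edge
      at \<open>p\<close>; its reversal directs this edge towards \<open>g k\<close>, which is the
      case already settled.\<close>
    then obtain a b where ab: "k \<preceq> a" "a \<preceq> p" "p \<prec> b" "b \<preceq> m" "g a = g b" by blast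
    have ab': "a \<preceq> b" using ab by order
    define h where "h = flip g a b"
    obtain j where j: "p \<oplus> (j \<oplus> \<one>) = a \<oplus> b" "a \<preceq> j" "j \<prec> b" using ab reflect_pos by blast
    then have j': "j \<oplus> (p \<oplus> \<one>) = a \<oplus> b" by (metis N.add.left_commute N.add.commute)
    have "h j = y" "h (j \<oplus> \<one>) = g k"
      using traverses_flip_inside[of a j b p g] j j' 3 by (auto simp: h_def)
    moreover have h: "Rf h" "trail R h m" "h m = g m" "uses h m u v \<longleftrightarrow> uses g m u v"
      "i \<preceq> k \<Longrightarrow> h i = g i" for u v i
      using g ab ab' unfolding h_def
      by (auto simp: uses_flip intro!: Rf_flip trail_flip flip_outside intro: N.order_trans)
    moreover have "k \<preceq> j" "j \<prec> m" "h k = g k" using ab j h(5)[of k] by (order, order, simp)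
    ultimately have "\<exists>g'. Rf g' \<and> trail R g' m \<and> g' m = h m \<and> (\<forall>u v. uses g' m u v \<longleftrightarrow> uses h m u v) \<and>
      (\<forall>i. i \<preceq> k \<longrightarrow> g' i = h i) \<and> g' (k \<oplus> \<one>) = y"
      using trail_advance_opposite[of h R m k j y] g(3) by metis
    then show ?thesis using h by metis
  qed
qed

section \<open>Rearranging one trail into a prolongation of another\<close>

lemma uses_cong:
  assumes "\<And>i. i \<preceq> n \<Longrightarrow> f i = g i"
  shows "uses f n u v \<longleftrightarrow> uses g n u v"
  using assms unfolding uses_def traverses_def by (metis N.less_imp_le less_leq_succ)

lemma trail_cong:
  assumes "\<And>i. i \<preceq> n \<Longrightarrow> f i = g i"
  shows "trail R f n \<longleftrightarrow> trail R g n"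
proof -
  have "f i = g i" "f (i \<oplus> \<one>) = g (i \<oplus> \<one>)" if "i \<prec> n" for i
    using that assms by (simp_all add: N.less_imp_le less_leq_succ)
  then show ?thesis by (auto simp: trail_def traverses_def)
qed

lemma uses_mono: "uses f k u v \<Longrightarrow> k \<preceq> n \<Longrightarrow> uses f n u v"
  unfolding uses_def using N.less_le_trans by blast

lemma trail_mono: "trail R f n \<Longrightarrow> k \<preceq> n \<Longrightarrow> trail R f k"
  unfolding trail_def using N.less_le_trans by blast

lemma trail_edge_fresh:
  "trail R f n \<Longrightarrow> j \<prec> n \<Longrightarrow> k \<preceq> j \<Longrightarrow> \<not> uses f k (f j) (f (j \<oplus> \<one>))"
  unfolding uses_def trail_def by (metis N.less_le_trans N.less_trans N.not_le)

text \<open>Connectivity enters through definable cuts \<open>S\<close>: that two vertices lie on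
  the same side is seen by following a path, by induction.\<close>

lemma path_constant:
  assumes "Ar S" "Rf f" and step: "\<And>i. k \<preceq> i \<Longrightarrow> i \<prec> n \<Longrightarrow> S (f i) \<longleftrightarrow> S (f (i \<oplus> \<one>))"
    and j: "k \<preceq> j" "j \<preceq> n"
  shows "S (f j) \<longleftrightarrow> S (f k)"
proof -
  have "k \<preceq> j \<and> j \<preceq> n \<longrightarrow> (S (f j) \<longleftrightarrow> S (f k))"
  proof (induction j rule: induct_M)
    case zero
    then show ?case by (metis leq_def basic(5))
  next
    case (succ j)
    show ?case
    proof
      assume a: "k \<preceq> j \<oplus> \<one> \<and> j \<oplus> \<one> \<preceq> n"
      then have "j \<prec> n" by (simp add: less_leq_succ)
      show "S (f (j \<oplus> \<one>)) \<longleftrightarrow> S (f k)"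
      proof (cases "k = j \<oplus> \<one>")
        case False
        then have "k \<preceq> j" using a by (metis less_succ leq_def)
        then show ?thesis using succ step \<open>j \<prec> n\<close> N.less_imp_le by blast
      qed simp
    qed
  next
    case definable
    show ?case by (intro Ar_intros Ar_comp[OF assms(1)] Rf_comp[OF assms(2)])
  qed
  with j show ?thesis by blast
qed

text \<open>The next edge of \<open>f\<close> occurs in \<open>g\<close> at a position
  \<open>p\<close> not before \<open>k\<close>, since the trails agree up to \<open>k\<close> and
  \<open>f\<close> repeats no edge. \<open>trail_advance\<close> moves it to \<open>k\<close>; its
  connectivity premise holds because the tail of \<open>f\<close>, if necessary together with a walk
  from its end, joins \<open>f (k \<oplus> \<one>)\<close> to \<open>f k\<close> without that
  edge.\<close>

lemma rearrange_step:
  assumes R: "symp R" and f: "Rf f" "trail R f n" and g: "Rf g" "trail R g m"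
    and sub: "\<And>i. i \<prec> n \<Longrightarrow> uses g m (f i) (f (i \<oplus> \<one>))"
    and conn: "\<And>k u. k \<preceq> n \<Longrightarrow> uses g m (f k) u \<Longrightarrow> \<not> uses f n (f k) u \<Longrightarrow>
      \<exists>d l. seq d \<zero> = f n \<and> seq d l = f k \<and> (\<forall>i. i \<prec> l \<longrightarrow>
        uses g m (seq d i) (seq d (i \<oplus> \<one>)) \<and> \<not> uses f n (seq d i) (seq d (i \<oplus> \<one>)))"
    and k: "k \<prec> n" "k \<preceq> m" "\<And>i. i \<preceq> k \<Longrightarrow> g i = f i"
  shows "k \<oplus> \<one> \<preceq> m \<and> (\<exists>g'. Rf g' \<and> trail R g' m \<and> g' m = g m \<and>
    (\<forall>u v. uses g' m u v \<longleftrightarrow> uses g m u v) \<and> (\<forall>i. i \<preceq> k \<oplus> \<one> \<longrightarrow> g' i = f i))"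
proof -
  have before: "traverses f q u v \<longleftrightarrow> traverses g q u v" if "q \<prec> k" for q u v
    using that k(3) by (simp add: traverses_def N.less_imp_le less_leq_succ)
  obtain p where p: "p \<prec> m" "traverses g p (f k) (f (k \<oplus> \<one>))"
    using sub[OF k(1)] by (auto simp: uses_def)
  have self: "traverses h i (h i) (h (i \<oplus> \<one>))" for h i by (simp add: traverses_def same_edge_def)
  have "k \<preceq> p"
  proof (rule ccontr)
    assume "\<not> k \<preceq> p"
    then have "p \<prec> k" by order
    then have "p = k" using before p(2) trail_unique[OF f(2) _ k(1) _ self] k(1) N.less_trans by metis
    then show False using \<open>\<not> k \<preceq> p\<close> by simp
  qed
  then have km: "k \<prec> m" using p(1) by order
  have "\<exists>g'. Rf g' \<and> trail R g' m \<and> g' m = g m \<and> (\<forall>u v. uses g' m u v \<longleftrightarrow> uses g m u v) \<and>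
    (\<forall>i. i \<preceq> k \<longrightarrow> g' i = g i) \<and> g' (k \<oplus> \<one>) = f (k \<oplus> \<one>)"
  proof (rule trail_advance[OF g R \<open>k \<preceq> p\<close> p(1)])
    show "traverses g p (g k) (f (k \<oplus> \<one>))" using p(2) k(3) by simp
    fix S
    assume S: "Ar S" "S (g k)" and neq: "g (k \<oplus> \<one>) \<noteq> f (k \<oplus> \<one>)"
      and cl: "\<And>q u v. k \<preceq> q \<Longrightarrow> q \<prec> m \<Longrightarrow> q \<noteq> p \<Longrightarrow> traverses g q u v \<Longrightarrow> S u \<Longrightarrow> S v"
    have edge: "S u \<longleftrightarrow> S v" if e: "uses g m u v" "\<not> uses f (k \<oplus> \<one>) u v" for u v
    proof -
      obtain q where q: "q \<prec> m" "traverses g q u v" using e(1) by (auto simp: uses_def)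
      have "k \<preceq> q"
        using e(2) before q(2) unfolding uses_def less_succ by (metis N.not_le N.less_imp_le)
      moreover have "q \<noteq> p"
      proof
        assume "q = p"
        then have "traverses f k u v" using q(2) p(2) unfolding traverses_def same_edge_def by metis
        then show False using e(2) less_succ unfolding uses_def by blast
      qed
      ultimately show ?thesis using cl q traverses_sym by blast
    qed
    have "k \<oplus> \<one> \<preceq> n" using k(1) by (simp add: less_leq_succ)
    \<comment> \<open>The later edges of \<open>f\<close> differ from its first
      \<open>k \<oplus> \<one>\<close> edges and are used by \<open>g\<close>, so none of them
      crosses the cut.\<close>
    have tail: "S (f j) \<longleftrightarrow> S (f (k \<oplus> \<one>))" if "k \<oplus> \<one> \<preceq> j" "j \<preceq> n" for j
    proof (rule path_constant[OF S(1) f(1) _ that])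
      fix i assume i: "k \<oplus> \<one> \<preceq> i" "i \<prec> n"
      show "S (f i) \<longleftrightarrow> S (f (i \<oplus> \<one>))"
        by (intro edge sub i trail_edge_fresh[OF f(2)])
    qed
    have x: "uses g m (f k) (g (k \<oplus> \<one>))" using uses_step[OF km, of g] k(3) by simp
    \<comment> \<open>The edge by which \<open>g\<close> leaves \<open>f k\<close> decides. If
      \<open>f\<close> uses it, then later than at \<open>k\<close>, so the tail returns to
      \<open>f k\<close>; if not, it is left over, and a walk leads from the end of \<open>f\<close>
      to \<open>f k\<close>.\<close>
    show "S (f (k \<oplus> \<one>))"
    proof (cases "uses f n (f k) (g (k \<oplus> \<one>))")
      case True
      then obtain j where j: "j \<prec> n" "traverses f j (f k) (g (k \<oplus> \<one>))" by (auto simp: uses_def)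
      have "\<not> j \<prec> k"
      proof
        assume "j \<prec> k"
        then have "j = k" using before[of j] j(2) trail_unique[OF g(2) _ km _ self] km N.less_trans k(3)
          by (metis N.order_refl)
        then show False using \<open>j \<prec> k\<close> by simp
      qed
      moreover have "j \<noteq> k" using j(2) neq by (auto simp: traverses_def same_edge_def)
      ultimately have "k \<prec> j" by order
      then have "k \<oplus> \<one> \<preceq> j" "k \<oplus> \<one> \<preceq> j \<oplus> \<one>" "j \<preceq> n" "j \<oplus> \<one> \<preceq> n"
        using j(1) by (simp_all add: less_leq_succ[symmetric] less_succ N.less_imp_le)
      then show ?thesis using tail[of j] tail[of "j \<oplus> \<one>"] j(2) S(2) k(3)
        by (auto simp: traverses_def same_edge_def)
    next
      case False
      then obtain d l where d: "seq d \<zero> = f n" "seq d l = f k" "\<And>i. i \<prec> l \<Longrightarrow>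
        uses g m (seq d i) (seq d (i \<oplus> \<one>)) \<and> \<not> uses f n (seq d i) (seq d (i \<oplus> \<one>))"
        using conn[OF _ x] k(1) N.less_imp_le by blast
      have "S (seq d l) \<longleftrightarrow> S (seq d \<zero>)"
      proof (rule path_constant[OF S(1), where f = "seq d"])
        show "Rf (seq d)" by (intro Rf_seq Ar_intros)
        show "S (seq d i) \<longleftrightarrow> S (seq d (i \<oplus> \<one>))" if "i \<prec> l" for i
          using d(3)[OF that] edge uses_mono[OF _ \<open>k \<oplus> \<one> \<preceq> n\<close>] by blast
      qed auto
      then have "S (f n)" using d S(2) k(3) by simp
      then show ?thesis using tail[of n] \<open>k \<oplus> \<one> \<preceq> n\<close> by simp
    qed
  qed
  then show ?thesis using km k(3) by (metis less_leq_succ less_succ leq_def)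
qed

text \<open>\<open>rearrange_step\<close> is iterated along \<open>f\<close>. The intermediate
  trails are replaced by codes, as the induction formula must not quantify over functions.\<close>

lemma rearrange:
  assumes R: "Ar (\<lambda>z. R (p1 z) (p2 z))" "symp R" and f: "Rf f" "trail R f n" and g: "Rf g" "trail R g m"
    and start: "g \<zero> = f \<zero>"
    and sub: "\<And>i. i \<prec> n \<Longrightarrow> uses g m (f i) (f (i \<oplus> \<one>))"
    and conn: "\<And>k u. k \<preceq> n \<Longrightarrow> uses g m (f k) u \<Longrightarrow> \<not> uses f n (f k) u \<Longrightarrow>
      \<exists>d l. seq d \<zero> = f n \<and> seq d l = f k \<and> (\<forall>i. i \<prec> l \<longrightarrow>
        uses g m (seq d i) (seq d (i \<oplus> \<one>)) \<and> \<not> uses f n (seq d i) (seq d (i \<oplus> \<one>)))"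
  shows "n \<preceq> m \<and> (\<exists>c. trail R (seq c) m \<and> seq c m = g m \<and>
    (\<forall>u v. uses (seq c) m u v \<longleftrightarrow> uses g m u v) \<and> (\<forall>i. i \<preceq> n \<longrightarrow> seq c i = f i))"
proof -
  have code: "\<exists>c. trail R (seq c) m \<and> seq c m = g m \<and>
      (\<forall>u v. uses (seq c) m u v \<longleftrightarrow> uses g m u v) \<and> (\<forall>i. i \<preceq> k \<longrightarrow> seq c i = f i)"
    if g': "Rf g'" "trail R g' m" "g' m = g m" "\<forall>u v. uses g' m u v \<longleftrightarrow> uses g m u v"
      "\<forall>i. i \<preceq> k \<longrightarrow> g' i = f i" "k \<preceq> m" for g' k
  proof -
    obtain c where c: "\<And>i. i \<preceq> m \<Longrightarrow> seq c i = g' i"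
      using seq_exists[OF g'(1), of "m \<oplus> \<one>"] by (auto simp: less_succ)
    then have "trail R (seq c) m" "\<And>u v. uses (seq c) m u v \<longleftrightarrow> uses g' m u v"
      using trail_cong[of m "seq c" g' R] uses_cong[of m "seq c" g'] g' by auto
    then show ?thesis using c g' by (metis N.order_refl N.order_trans)
  qed
  have "k \<preceq> n \<longrightarrow> k \<preceq> m \<and> (\<exists>c. trail R (seq c) m \<and> seq c m = g m \<and>
    (\<forall>u v. uses (seq c) m u v \<longleftrightarrow> uses g m u v) \<and> (\<forall>i. i \<preceq> k \<longrightarrow> seq c i = f i))" for k
  proof (induction k rule: induct_M)
    case zero
    have "i \<preceq> \<zero> \<longleftrightarrow> i = \<zero>" for i by (simp add: leq_def)
    then show ?case using code[OF g, of \<zero>] start by simp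
  next
    case (succ k)
    show ?case
    proof
      assume "k \<oplus> \<one> \<preceq> n"
      then have k: "k \<prec> n" by (simp add: less_leq_succ)
      with succ N.less_imp_le obtain c where c: "k \<preceq> m" "trail R (seq c) m" "seq c m = g m"
        "\<And>u v. uses (seq c) m u v \<longleftrightarrow> uses g m u v" "\<And>i. i \<preceq> k \<Longrightarrow> seq c i = f i" by blast
      have "Rf (seq c)" by (intro Rf_seq Ar_intros)
      then have "k \<oplus> \<one> \<preceq> m \<and> (\<exists>g'. Rf g' \<and> trail R g' m \<and> g' m = seq c m \<and>
        (\<forall>u v. uses g' m u v \<longleftrightarrow> uses (seq c) m u v) \<and> (\<forall>i. i \<preceq> k \<oplus> \<one> \<longrightarrow> g' i = f i))"
        by (rule rearrange_step[OF R(2) f _ c(2) _ _ k c(1) c(5)], unfold c(4))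
          (erule sub, erule (2) conn, assumption)
      then show "k \<oplus> \<one> \<preceq> m \<and> (\<exists>c. trail R (seq c) m \<and> seq c m = g m \<and>
        (\<forall>u v. uses (seq c) m u v \<longleftrightarrow> uses g m u v) \<and> (\<forall>i. i \<preceq> k \<oplus> \<one> \<longrightarrow> seq c i = f i))"
        using code c(3,4) by metis
    qed
  next
    case definable
    show ?case unfolding trail_def uses_def traverses_def same_edge_def
      by (intro Ar_intros Rf_seq Ar_binary[OF R(1)] Rf_comp[OF f(1)] Rf_comp[OF g(1)])
  qed
  then show ?thesis by simp
qed

section \<open>Extendable trails\<close>

definition remaining where
  "remaining R f n u v \<longleftrightarrow> R u v \<and> \<not> uses f n u v"

definition walk where
  "walk R f n d l u \<longleftrightarrow> seq d \<zero> = f n \<and> seq d l = u \<and>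
     (\<forall>i. i \<prec> l \<longrightarrow> remaining R f n (seq d i) (seq d (i \<oplus> \<one>)))"

text \<open>The walks may repeat edges, as only connectedness of what is left matters. The first
  conjunct excludes dead ends: with no edge left, a trail cannot go on.\<close>

definition loose where
  "loose R f n \<longleftrightarrow> (\<exists>u v. remaining R f n u v) \<and>
     (\<forall>u v. remaining R f n u v \<longrightarrow> (\<exists>d l. walk R f n d l u))"

text \<open>Every finite set of edges lies below some bound on vertices, so a number can replace a
  code of the set.\<close>

definition covers where
  "covers R f n b \<longleftrightarrow> (\<forall>u. u \<prec> b \<longrightarrow> (\<forall>v. v \<prec> b \<longrightarrow> R u v \<longrightarrow> uses f n u v))"

definition extendable where
  "extendable R f n \<longleftrightarrow> trail R f n \<and> (\<forall>b. \<exists>c m. n \<preceq> m \<and> (\<forall>i. i \<preceq> n \<longrightarrow> seq c i = f i) \<and>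
     trail R (seq c) m \<and> covers R (seq c) m b \<and> loose R (seq c) m)"

lemmas trail_defs = trail_def uses_def traverses_def same_edge_def remaining_def walk_def loose_def
  covers_def extendable_def

text \<open>The relation depends on \<open>a c\<close>, which gives definability uniformly in the
  index of a graph, as the comprehension over all indices demands.\<close>

lemma Ar_extendable:
  assumes A: "Ar (\<lambda>z. A (p1 z) (p1 (p2 z)) (p2 (p2 z)))" and "Rf a" "Rf f" "Rf g"
  shows "Ar (\<lambda>c. extendable (A (a c)) (seq (f c)) (g c))"
proof -
  have A': "Rf a' \<Longrightarrow> Rf f' \<Longrightarrow> Rf g' \<Longrightarrow> Ar (\<lambda>c. A (a' c) (f' c) (g' c))" for a' f' g'
    using Ar_comp[OF A Rf_pair[OF _ Rf_pair], of a' f' g'] by simp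
  have "Ar (\<lambda>z. extendable (A (p1 z)) (seq (p1 (p2 z))) (p2 (p2 z)))"
    unfolding trail_defs by (intro Ar_intros Rf_seq A')
  from Ar_comp[OF this Rf_pair[OF assms(2) Rf_pair[OF assms(3,4)]]] show ?thesis by simp
qed

lemma p1_leq: "p1 c \<preceq> c"
  by (cases "\<exists>m n. c = pair m n") (auto simp: p1_def)

lemma loose_cong:
  assumes "f n = g n" "\<And>u v. uses f n u v \<longleftrightarrow> uses g n u v"
  shows "loose R f n \<longleftrightarrow> loose R g n"
  by (simp add: loose_def walk_def remaining_def assms)

lemma covers_mono: "covers R f n b \<Longrightarrow> b' \<preceq> b \<Longrightarrow> covers R f n b'"
  unfolding covers_def using N.less_le_trans by blast

text \<open>The trail has boundedly many positions, so collection applies. Vertices of a walk are at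
  most its code; hence a trail that covers \<open>B\<close> uses all edges of these walks.\<close>

lemma walks_bounded:
  assumes R: "Ar (\<lambda>z. R (p1 z) (p2 z))" and f: "Rf f" and "loose R f n"
  shows "\<exists>B. \<forall>k u. k \<preceq> n \<longrightarrow> remaining R f n (f k) u \<longrightarrow> (\<exists>d l. walk R f n d l (f k) \<and> d \<prec> B)"
proof -
  \<comment> \<open>Collection asks for a \<open>y\<close> at each \<open>k\<close>; the implication
    provides one where no edge remains at \<open>f k\<close>.\<close>
  define P where "P k y \<longleftrightarrow> (\<exists>u. remaining R f n (f k) u) \<longrightarrow> walk R f n (p1 y) (p2 y) (f k)" for k y
  have "Ar (\<lambda>z. P (p1 z) (p2 z))" unfolding P_def trail_defs
    by (intro Ar_intros Rf_seq Ar_binary[OF R] Rf_comp[OF f])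
  moreover have "\<exists>y. P k y" for k
  proof -
    have "\<exists>d l. (\<exists>u. remaining R f n (f k) u) \<longrightarrow> walk R f n d l (f k)"
      using assms(3) unfolding loose_def by blast
    then show ?thesis unfolding P_def by (metis p1_pair p2_pair)
  qed
  ultimately obtain B where B: "\<And>k. k \<prec> n \<oplus> \<one> \<Longrightarrow> \<exists>y. y \<prec> B \<and> P k y"
    using collection by blast
  show ?thesis
  proof (rule exI[of _ B], intro allI impI)
    fix k u assume "k \<preceq> n" "remaining R f n (f k) u"
    then obtain y where "y \<prec> B" "walk R f n (p1 y) (p2 y) (f k)"
      using B by (auto simp: P_def less_succ)
    then show "\<exists>d l. walk R f n d l (f k) \<and> d \<prec> B" using p1_leq N.le_less_trans by blast
  qed
qed

text \<open>For a large enough bound, the witness for the shorter trail uses every edge of the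
  longer one and of the walks from its end, and \<open>rearrange\<close> makes it begin with the
  longer one. This changes neither its end nor its set of edges, so \<open>covers\<close> and
  \<open>loose\<close> survive.\<close>

lemma extendable_continues:
  assumes R: "Ar (\<lambda>z. R (p1 z) (p2 z))" "symp R" and f: "extendable R f n"
    and c: "n \<preceq> m" "\<And>i. i \<preceq> n \<Longrightarrow> seq c i = f i" "trail R (seq c) m" "loose R (seq c) m"
  shows "extendable R (seq c) m"
  unfolding extendable_def
proof (intro conjI allI c(3))
  fix b
  have F: "Rf (seq c)" by (intro Rf_seq Ar_intros)
  obtain B where B: "\<And>k u. k \<preceq> m \<Longrightarrow> remaining R (seq c) m (seq c k) u \<Longrightarrow>
      \<exists>d l. walk R (seq c) m d l (seq c k) \<and> d \<prec> B"
    using walks_bounded[OF R(1) F c(4)] by blast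
  \<comment> \<open>\<open>B\<close> takes care of the walks, and \<open>c\<close> of the trail,
    whose vertices are at most its code.\<close>
  define b' where "b' = b \<oplus> (B \<oplus> (c \<oplus> \<one>))"
  have b': "b \<preceq> b'" "B \<preceq> b'" "c \<prec> b'" unfolding b'_def
    by (simp, metis N.add.left_commute N.le_add_same_cancel1 zero_leq, metis N.add.assoc N.add.commute less_plus)
  obtain c' m' where c': "n \<preceq> m'" "\<And>i. i \<preceq> n \<Longrightarrow> seq c' i = f i" "trail R (seq c') m'"
    "covers R (seq c') m' b'" "loose R (seq c') m'" using f unfolding extendable_def by blast
  have F': "Rf (seq c')" by (intro Rf_seq Ar_intros)
  have "m \<preceq> m' \<and> (\<exists>c2. trail R (seq c2) m' \<and> seq c2 m' = seq c' m' \<and>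
    (\<forall>u v. uses (seq c2) m' u v \<longleftrightarrow> uses (seq c') m' u v) \<and> (\<forall>i. i \<preceq> m \<longrightarrow> seq c2 i = seq c i))"
  proof (rule rearrange[OF R F c(3) F' c'(3)])
    show "seq c' \<zero> = seq c \<zero>" using c(2) c'(2) by simp
    show "uses (seq c') m' (seq c i) (seq c (i \<oplus> \<one>))" if "i \<prec> m" for i
      using c'(4) trail_edge[OF c(3) that] seq_leq N.le_less_trans b'(3) unfolding covers_def by metis
    fix k u
    assume "k \<preceq> m" and u: "uses (seq c') m' (seq c k) u" "\<not> uses (seq c) m (seq c k) u"
    have "remaining R (seq c) m (seq c k) u"
      unfolding remaining_def using trail_uses_R[OF c'(3) R(2)] u by blast
    then obtain d l where d: "walk R (seq c) m d l (seq c k)" "d \<prec> B" using B \<open>k \<preceq> m\<close> by blast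
    have "seq d i \<prec> b'" for i using seq_leq[of d i] d(2) b'(2) by order
    then show "\<exists>d l. seq d \<zero> = seq c m \<and> seq d l = seq c k \<and> (\<forall>i. i \<prec> l \<longrightarrow>
        uses (seq c') m' (seq d i) (seq d (i \<oplus> \<one>)) \<and> \<not> uses (seq c) m (seq d i) (seq d (i \<oplus> \<one>)))"
      using d(1) c'(4) unfolding walk_def remaining_def covers_def by blast
  qed
  then obtain c2 where c2: "m \<preceq> m'" "trail R (seq c2) m'" "seq c2 m' = seq c' m'"
    "\<And>u v. uses (seq c2) m' u v \<longleftrightarrow> uses (seq c') m' u v" "\<And>i. i \<preceq> m \<Longrightarrow> seq c2 i = seq c i" by blast
  have "loose R (seq c2) m'" using loose_cong[OF c2(3,4)] c'(5) by blast
  moreover have "covers R (seq c2) m' b"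
    using covers_mono[OF c'(4) b'(1)] by (simp add: covers_def c2(4))
  ultimately show "\<exists>c' m'. m \<preceq> m' \<and> (\<forall>i. i \<preceq> m \<longrightarrow> seq c' i = seq c i) \<and>
     trail R (seq c') m' \<and> covers R (seq c') m' b \<and> loose R (seq c') m'" using c2 by blast
qed

text \<open>The strict inequality forces progress, so that iterated extensions reach every
  position.\<close>

definition extension where
  "extension R f n b c m \<longleftrightarrow> n \<prec> m \<and> (\<forall>i. i \<preceq> n \<longrightarrow> seq c i = f i) \<and> covers R (seq c) m b \<and>
     extendable R (seq c) m"

text \<open>An edge that \<open>f\<close> does not use is found behind the end of a loose
  prolongation \<open>c0\<close>. A second prolongation, chosen to cover this edge, is strictly
  longer than \<open>f\<close>.\<close>

lemma extension_exists:
  assumes R: "Ar (\<lambda>z. R (p1 z) (p2 z))" "symp R" and f: "extendable R f n"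
  shows "\<exists>c m. extension R f n b c m"
proof -
  obtain c0 m0 where c0: "n \<preceq> m0" "\<And>i. i \<preceq> n \<Longrightarrow> seq c0 i = f i" "loose R (seq c0) m0"
    using f unfolding extendable_def by blast
  then obtain u v where uv: "R u v" "\<not> uses (seq c0) m0 u v" by (auto simp: loose_def remaining_def)
  then have unused: "\<not> uses f n u v" using uses_cong[of n "seq c0" f] c0(2) uses_mono[OF _ c0(1)] by blast
  define b' where "b' = b \<oplus> (u \<oplus> (v \<oplus> \<one>))"
  have b': "b \<preceq> b'" "u \<prec> b'" "v \<prec> b'" unfolding b'_def
    by (simp, metis N.add.left_commute less_plus N.add.assoc, metis N.add.assoc N.add.commute less_plus)
  obtain c m where c: "n \<preceq> m" "\<And>i. i \<preceq> n \<Longrightarrow> seq c i = f i" "trail R (seq c) m"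
    "covers R (seq c) m b'" "loose R (seq c) m" using f unfolding extendable_def by blast
  have "n \<noteq> m" using c(4) uv(1) b' unused uses_cong[of n "seq c" f] c(2)
    unfolding covers_def by blast
  then show ?thesis unfolding extension_def
    using c covers_mono[OF c(4) b'(1)] extendable_continues[OF R f c(1-3,5)]
    by (metis leq_def)
qed

section \<open>Euler paths are the limits of extendable trails\<close>

definition euler where
  "euler R f \<longleftrightarrow> Rf f \<and> (\<forall>n. R (f n) (f (n \<oplus> \<one>))) \<and> (\<forall>u v. R u v \<longrightarrow> (\<exists>!n. traverses f n u v))"

lemma euler_imp_trail: "euler R f \<Longrightarrow> trail R f n"
  unfolding euler_def trail_def by (metis traverses_def same_edge_def)

text \<open>The rest of the path is itself a walk through remaining edges, and it visits both ends
  of each of them.\<close>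

lemma euler_imp_loose:
  assumes e: "euler R f"
  shows "loose R f n"
  unfolding loose_def
proof (intro conjI allI impI)
  have rem: "remaining R f n (f j) (f (j \<oplus> \<one>))" if "n \<preceq> j" for j
    using e that trail_edge_fresh[OF euler_imp_trail[OF e] _ that, of "j \<oplus> \<one>"]
    by (simp add: remaining_def euler_def)
  then show "\<exists>u v. remaining R f n u v" by blast
  fix u v assume uv: "remaining R f n u v"
  then obtain j where j: "traverses f j u v" using e unfolding euler_def remaining_def by blast
  then have "n \<preceq> j" using uv unfolding remaining_def uses_def using N.not_le by blast
  moreover have "n \<preceq> j \<oplus> \<one>" using \<open>n \<preceq> j\<close> less_succ N.less_imp_le by blast
  ultimately obtain j' where "n \<preceq> j'" "u = f j'"
    using j unfolding traverses_def same_edge_def by metis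
  then obtain l where l: "u = f (n \<oplus> l)" unfolding leq_iff by blast
  have "Rf f" using e by (simp add: euler_def)
  then have "Rf (\<lambda>i. f (n \<oplus> i))" by (rule Rf_comp) (intro Ar_intros)
  then obtain d where d: "\<And>i. i \<preceq> l \<Longrightarrow> seq d i = f (n \<oplus> i)"
    using seq_exists[of "\<lambda>i. f (n \<oplus> i)" "l \<oplus> \<one>"] by (auto simp: less_succ)
  have "walk R f n d l u" unfolding walk_def
    using d l rem by (auto simp: less_leq_succ basic_rec(1) N.less_imp_le)
  then show "\<exists>d l. walk R f n d l u" by blast
qed

text \<open>Collection over codes of pairs bounds the positions at which the edges below
  \<open>b\<close> are traversed.\<close>

lemma euler_imp_covers:
  assumes R: "Ar (\<lambda>z. R (p1 z) (p2 z))" and e: "euler R f"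
  shows "\<exists>m. covers R f m b"
proof -
  have f: "Rf f" using e by (simp add: euler_def)
  define P where "P z y \<longleftrightarrow> R (p1 z) (p2 z) \<longrightarrow> traverses f y (p1 z) (p2 z)" for z y
  have "Ar (\<lambda>z. P (p1 z) (p2 z))" unfolding P_def trail_defs
    by (intro Ar_intros Ar_binary[OF R] Rf_comp[OF f])
  moreover have "\<exists>y. P z y" for z using e unfolding P_def euler_def by blast
  ultimately obtain m where m: "\<And>z. z \<prec> pair b b \<Longrightarrow> \<exists>y. y \<prec> m \<and> P z y"
    using collection by blast
  have "uses f m u v" if "u \<prec> b" "v \<prec> b" "R u v" for u v
    using m[of "pair u v"] pair_mono[of u v b b] N.add_strict_mono that
    by (auto simp: P_def uses_def)
  then show ?thesis unfolding covers_def by blast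
qed

lemma euler_imp_extendable:
  assumes R: "Ar (\<lambda>z. R (p1 z) (p2 z))" and e: "euler R f"
  shows "\<exists>c. extendable R (seq c) \<zero>"
proof -
  have f: "Rf f" using e by (simp add: euler_def)
  have code: "\<exists>c. \<forall>i. i \<preceq> m \<longrightarrow> seq c i = f i" for m
    using seq_exists[OF f, of "m \<oplus> \<one>"] by (simp add: less_succ)
  then obtain c where c: "seq c \<zero> = f \<zero>" by blast
  have "extendable R (seq c) \<zero>" unfolding extendable_def
  proof (intro conjI allI)
    fix b
    obtain m where m: "covers R f m b" using euler_imp_covers[OF R e] by blast
    obtain d where d: "\<And>i. i \<preceq> m \<Longrightarrow> seq d i = f i" using code by blast
    have u: "uses (seq d) m u v \<longleftrightarrow> uses f m u v" for u v using uses_cong d by blast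
    have "trail R (seq d) m" using trail_cong[of m "seq d" f R] d euler_imp_trail[OF e] by blast
    moreover have "covers R (seq d) m b" using m by (simp add: covers_def u)
    moreover have "loose R (seq d) m" using loose_cong[of "seq d" m f R] d u euler_imp_loose[OF e] by simp
    moreover have "\<forall>i. i \<preceq> \<zero> \<longrightarrow> seq d i = seq c i" using c d[of \<zero>] by (auto simp: leq_def[of _ \<zero>])
    ultimately show "\<exists>d m. \<zero> \<preceq> m \<and> (\<forall>i. i \<preceq> \<zero> \<longrightarrow> seq d i = seq c i) \<and>
      trail R (seq d) m \<and> covers R (seq d) m b \<and> loose R (seq d) m" by (metis zero_leq)
  qed (simp add: trail_def)
  then show ?thesis by blast
qed

text \<open>\<open>F s\<close> holds a coded trail and its length. Stage \<open>s\<close> passes to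
  an extension that covers the edges below \<open>s\<close>, so every edge is used
  eventually.\<close>

lemma extendable_imp_euler:
  assumes R: "Ar (\<lambda>z. R (p1 z) (p2 z))" "symp R" and c0: "extendable R (seq c0) \<zero>"
  shows "\<exists>f. euler R f"
proof -
  have Ar_ext: "Ar (\<lambda>c. extendable R (seq (f c)) (g c))" if "Rf f" "Rf g" for f g
    by (rule Ar_extendable[of "\<lambda>_. R", OF _ Rf_id that]) (intro Ar_binary[OF R(1)] Ar_intros)
  define next_ext where
    "next_ext s x y \<longleftrightarrow> extension R (seq (p1 x)) (p2 x) s (p1 y) (p2 y)" for s x y
  \<comment> \<open>The default of \<open>least\<close> makes \<open>h\<close> total; that a genuine
    extension is chosen at every stage is proved afterwards, together with extendability.\<close>
  define h where "h z = least (next_ext (p1 z) (p2 z))" for z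
  have "Ar (\<lambda>z. next_ext (p1 (p1 z)) (p2 (p1 z)) (p2 z))"
    unfolding next_ext_def extension_def covers_def uses_def traverses_def same_edge_def
    by (intro Ar_intros Rf_seq Ar_binary[OF R(1)] Ar_ext)
  then have "Rf h" unfolding h_def by (intro Rf_least)
  then obtain F where F: "Rf F" "F \<zero> = pair c0 \<zero>" "\<And>s. F (s \<oplus> \<one>) = h (pair s (F s))"
    using recursion by blast
  define t where "t s = seq (p1 (F s))" for s
  define len where "len s = p2 (F s)" for s
  have step: "extension R (t s) (len s) s (p1 (F (s \<oplus> \<one>))) (len (s \<oplus> \<one>))"
    if "extendable R (t s) (len s)" for s
  proof -
    have "Ar (\<lambda>y. next_ext s (F s) y)"
      unfolding next_ext_def extension_def covers_def uses_def traverses_def same_edge_def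
      by (intro Ar_intros Rf_seq Ar_binary[OF R(1)] Ar_ext)
    moreover obtain c m where "extension R (t s) (len s) s c m"
      using extension_exists[OF R \<open>extendable R (t s) (len s)\<close>] by blast
    then have "next_ext s (F s) (pair c m)" by (simp add: next_ext_def t_def len_def)
    ultimately have "next_ext s (F s) (h (pair s (F s)))"
      unfolding h_def by (simp add: least_holds)
    then show ?thesis by (simp add: next_ext_def F(3) t_def len_def)
  qed
  have ext: "extendable R (t s) (len s)" for s
  proof (induction s rule: induct_M)
    case zero
    then show ?case using c0 by (simp add: t_def len_def F(2))
  next
    case (succ s)
    then show ?case using step[OF succ] by (simp add: extension_def t_def)
  next
    case definable
    show ?case unfolding t_def len_def by (intro Ar_ext Ar_intros Rf_comp[OF F(1)])
  qed
  have step: "len s \<prec> len (s \<oplus> \<one>)" "\<And>i. i \<preceq> len s \<Longrightarrow> t (s \<oplus> \<one>) i = t s i"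
    "covers R (t (s \<oplus> \<one>)) (len (s \<oplus> \<one>)) s" for s
    using step[OF ext[of s]] by (auto simp: extension_def t_def)
  have len: "s \<preceq> len s" for s
  proof (induction s rule: induct_M)
    case (succ s)
    then show ?case using step(1)[of s] by (metis N.le_less_trans less_leq_succ)
  next
    case definable
    show ?case unfolding len_def by (intro Ar_intros Rf_comp[OF F(1)])
  qed simp
  have coherent: "len s \<preceq> len (s \<oplus> k) \<and> (\<forall>i. i \<preceq> len s \<longrightarrow> t (s \<oplus> k) i = t s i)" for s k
  proof (induction k rule: induct_M)
    case (succ k)
    then have "t (s \<oplus> k \<oplus> \<one>) i = t s i" if "i \<preceq> len s" for i
      using step(2)[of i "s \<oplus> k"] that N.order_trans by simp
    moreover have "len s \<preceq> len (s \<oplus> k \<oplus> \<one>)"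
      using succ[THEN conjunct1] step(1)[of "s \<oplus> k"] by order
    ultimately show ?case by (simp add: basic_rec(1))
  next
    case definable
    show ?case unfolding len_def t_def by (intro Ar_intros Rf_seq Rf_comp[OF F(1)])
  qed simp
  \<comment> \<open>Stage \<open>n\<close> has length at least \<open>n\<close>, so its entry at
    \<open>n\<close> is final.\<close>
  define f where "f n = t n n" for n
  have f: "f i = t s i" if "i \<preceq> len s" for i s
  proof (cases "i \<preceq> s")
    case True
    then show ?thesis using coherent[of i] len[of i] unfolding f_def leq_iff[of i s] by metis
  next
    case False
    then have "s \<preceq> i" by order
    then show ?thesis using coherent[of s] that unfolding f_def leq_iff[of s i] by metis
  qed
  have trail: "trail R f n" for n
  proof -
    have "trail R (t n) (len n)" using ext by (simp add: extendable_def)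
    then have "trail R f (len n)" using trail_cong[of "len n" f "t n"] f by blast
    then show ?thesis using trail_mono len by blast
  qed
  have "\<exists>i. traverses f i u v" if "R u v" for u v
  proof -
    define s where "s = u \<oplus> (v \<oplus> \<one>)"
    have "u \<prec> s" "v \<prec> s" unfolding s_def by (rule less_plus, metis N.add.left_commute less_plus)
    then have "uses (t (s \<oplus> \<one>)) (len (s \<oplus> \<one>)) u v" using step(3)[of s] that by (simp add: covers_def)
    then have "uses f (len (s \<oplus> \<one>)) u v" using uses_cong[of "len (s \<oplus> \<one>)" f] f by blast
    then show ?thesis by (auto simp: uses_def)
  qed
  moreover have "i = j" if "traverses f i u v" "traverses f j u v" for i j u v
  proof -
    have "i \<prec> i \<oplus> (j \<oplus> \<one>)" "j \<prec> i \<oplus> (j \<oplus> \<one>)" by (rule less_plus, metis N.add.left_commute less_plus)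
    then show ?thesis using trail_unique[OF trail] that by blast
  qed
  moreover have "R (f n) (f (n \<oplus> \<one>))" for n
    using trail_edge[OF trail N.less_add_one] .
  moreover have "Rf f" unfolding f_def t_def by (intro Rf_seq Ar_intros Rf_comp[OF F(1)])
  ultimately show ?thesis unfolding euler_def by blast
qed

lemma euler_iff_extendable:
  assumes "Ar (\<lambda>z. R (p1 z) (p2 z))" "symp R"
  shows "(\<exists>f. euler R f) \<longleftrightarrow> (\<exists>c. extendable R (seq c) \<zero>)"
  using assms euler_imp_extendable extendable_imp_euler by blast

lemma has_euler_path_iff:
  assumes "is_graph V E"
  shows "has_euler_path M V E \<longleftrightarrow> (\<exists>f. euler (\<lambda>u v. (u, v) \<in> E) f)"
proof -
  have "is_euler_path M V E f \<longleftrightarrow> euler (\<lambda>u v. (u, v) \<in> E) f" for f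
  proof -
    have tr: "{f n, f (n \<oplus> \<one>)} = {u, v} \<longleftrightarrow> traverses f n u v" for n u v
      by (simp add: doubleton_eq_iff traverses_def same_edge_def)
    have "\<forall>n. (f n, f (n \<oplus> \<one>)) \<in> E \<Longrightarrow> f n \<in> V" for n
      using assms by (auto simp: is_graph_def)
    then have "(\<forall>n. f n \<in> V) \<and> (\<forall>n. (f n, f (n \<oplus> \<one>)) \<in> E) \<longleftrightarrow> (\<forall>n. (f n, f (n \<oplus> \<one>)) \<in> E)"
      by blast
    moreover have "(\<forall>(u, v)\<in>E. \<exists>!n. traverses f n u v) \<longleftrightarrow> (\<forall>u v. (u, v) \<in> E \<longrightarrow> (\<exists>!n. traverses f n u v))"
      by blast
    ultimately show ?thesis
      unfolding is_euler_path_def is_path_def euler_def tr by simp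
  qed
  then show ?thesis by (simp add: has_euler_path_def)
qed

lemma euler_path_sets_exist: "euler_path_sets_exist M"
  unfolding euler_path_sets_exist_def
proof (intro allI impI)
  fix VV EE assume G: "graph_sequence M VV EE"
  define A where "A i u v \<longleftrightarrow> (u, v) \<in> edges_at M EE i" for i u v
  have "EE \<in> setsM M" using G by (simp add: graph_sequence_def)
  then have A: "Rf a \<Longrightarrow> Rf f \<Longrightarrow> Rf g \<Longrightarrow> Ar (\<lambda>c. A (a c) (f c) (g c))" for a f g
    unfolding A_def edges_at_def by simp (intro Ar_intros)
  have "symp (A i)" for i
    using G unfolding graph_sequence_def is_graph_def A_def by (auto simp: symp_def sym_def)
  then have "has_euler_path M (vertices_at M VV i) (edges_at M EE i) \<longleftrightarrow> (\<exists>c. extendable (A i) (seq c) \<zero>)" for i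
    using has_euler_path_iff G euler_iff_extendable[of "A i"] A[OF Rf_const Rf_p1 Rf_p2] Rf_id
    unfolding graph_sequence_def A_def by blast
  \<comment> \<open>With the sequence of graphs fixed, the condition is arithmetical in the index
    \<open>i\<close>; it defines the required set.\<close>
  moreover have "Ar (\<lambda>i. \<exists>c. extendable (A i) (seq c) \<zero>)"
    by (intro Ar_ex Ar_extendable[of A] A Ar_intros)
  ultimately show "\<exists>Z\<in>setsM M. \<forall>i. i \<in> Z \<longleftrightarrow> has_euler_path M (vertices_at M VV i) (edges_at M EE i)"
    by (intro bexI[of _ "{i. \<exists>c. extendable (A i) (seq c) \<zero>}"]) (simp_all add: Ar_def)
qed

end

theorem theorem21:
  fixes M :: "'a l2_struct"
  assumes "RCA0 M"
  shows "ACA0 M \<longleftrightarrow> euler_path_sets_exist M"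
proof
  interpret rca M using assms by unfold_locales
  show "euler_path_sets_exist M \<Longrightarrow> ACA0 M"
    by (intro ACA0_if_projection_closed projection_closed_if_euler_path_sets_exist)
  assume "ACA0 M"
  then interpret aca M using ACA0_imp_projection_closed by unfold_locales
  show "euler_path_sets_exist M" by (rule euler_path_sets_exist)
qed

end
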